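(* Let $L\in\mathbb{C}^{n\times n}$ be a Hermitian matrix with eigendecomposition $L=U\,\mathrm{diag}(\lambda)\,U^\dagger$, where $U$ is unitary and $\lambda$ is real. Let $1\le R\le n$ be the number of retained eigenmodes, labelled $\xi=1,\dots,R$. Define the rotated modes $\hat a_\xi^\dagger=\sum_{p=1}^n U_{p\xi}a_p^\dagger$, the occupation operators $\hat n_\xi=\hat a_\xi^\dagger\hat a_\xi$, and $$\hat O=\sum_{\xi=1}^{R}\lambda_\xi\,\hat n_\xi,\qquad \Gamma=\sum_{\xi=1}^{R}|\lambda_\xi|,$$ and assume $\Gamma>0$. Let $\mathfrak a_I=\lceil\log_2 R\rceil$ (binary index register) or $\mathfrak a_I=R$ (unary index register). Then, for either choice of $\mathfrak a_I$, $\hat O^2$ admits a $(\Gamma^2,\ \mathfrak a_I+2,\ 0)$ block encoding. Concretely, such a block encoding is obtained in two steps: (1) $\hat O$ admits a $(\Gamma,\mathfrak a_I+1,0)$ block encoding $U_{\hat O}$ of the form $\mathrm{PREP}^\dagger\cdot\mathrm{SELECT}\cdot\mathrm{PREP}$ over the commuting projectors $\{\hat n_\xi\}_{\xi=1}^R$, with the sign of $\lambda_\xi$ included as a branch phase; (2) a $(\Gamma^2,\mathfrak a_I+2,0)$ block encoding of $\hat O^2$ is obtained from $U_{\hat O}$ by a fixed degree-2 quantum singular value transformation (QSVT/QSP) circuit implementing the polynomial $x\mapsto x^2$ on $\hat O/\Gamma$.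
   Context: The $n$-qubit system space $(\mathbb{C}^2)^{\otimes n}$ is identified with the fermionic Fock space on $n$ spin-orbitals (one qubit per spin-orbital, e.g. Jordan--Wigner), and $a_p^\dagger,a_p$ are the standard fermionic creation/annihilation operators. Block encoding: for $\alpha>0$, $t\in\mathbb{N}$, $\epsilon\ge0$, a unitary $W$ on $(\mathbb{C}^2)^{\otimes t}\otimes(\mathbb{C}^2)^{\otimes n}$ is an $(\alpha,t,\epsilon)$ block encoding of an operator $\hat A$ on the system if $\|\Pi[(\langle 0^t|\otimes I)W(|0^t\rangle\otimes I)-\hat A/\alpha]\Pi\|\le\epsilon$ in operator norm, where $\Pi$ is the orthogonal projector onto the working subspace, a fixed particle-number sector $\mathcal H_{N_e}$ of the Fock space (with $N_e$ arbitrary). In step (1), the ancillas are an index register of $\mathfrak a_I$ qubits, with orthonormal states $|\xi\rangle$, $1\le\xi\le R$ (computational basis states in the binary case, one-hot states in the unary case), and one flag qubit. PREP is a unitary on the index register with $\mathrm{PREP}|0\rangle=\Gamma^{-1/2}\sum_{\xi=1}^R\sqrt{|\lambda_\xi|}\,|\xi\rangle$. SELECT is a unitary that, for each $\xi$, applies $\operatorname{sgn}(\lambda_\xi)\,W_\xi$ to flag and system when the index register is in $|\xi\rangle$, where $W_\xi$ is a $(1,1,0)$ block encoding of $\hat n_\xi$ using the flag qubit as ancilla (on index states outside $\mathrm{span}\{|\xi\rangle\}$ it acts as the identity; if $\lambda_\xi=0$ the sign is taken to be $1$). In step (2), a degree-2 QSVT circuit adjoins one further ancilla (signal) qubit and consists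 of two uses of $U_{\hat O}$ and/or $U_{\hat O}^\dagger$ interleaved with fixed gates acting on the ancilla registers only (independent of the values $\lambda_\xi$).
   Formalization: Step (2) for arbitrary block encodings W_ξ additionally assumes that their encoded blocks map the working particle-number sector into itself; without this the squared block can differ from Ô²/Γ². Suitable W_ξ are shown to exist, so Ô² has its block encoding unconditionally. *)

theory Defs
  imports Complex_Main "Jordan_Normal_Form.Schur_Decomposition"
begin

section \<open>Matrices\<close>

definition unitary_mat :: "nat \<Rightarrow> complex mat \<Rightarrow> bool" where
  "unitary_mat d A \<longleftrightarrow>
     A \<in> carrier_mat d d \<and> mat_adjoint A * A = 1\<^sub>m d \<and> A * mat_adjoint A = 1\<^sub>m d"

definition hermitian_mat :: "nat \<Rightarrow> complex mat \<Rightarrow> bool" where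
  "hermitian_mat d A \<longleftrightarrow> A \<in> carrier_mat d d \<and> mat_adjoint A = A"

text \<open>Kronecker product; the left factor carries the most significant part of the index.\<close>
definition tensor_mat :: "complex mat \<Rightarrow> complex mat \<Rightarrow> complex mat"  (infixr "\<otimes>\<^sub>m" 72) where
  "A \<otimes>\<^sub>m B = mat (dim_row A * dim_row B) (dim_col A * dim_col B)
     (\<lambda>(i, j). A $$ (i div dim_row B, j div dim_col B) * B $$ (i mod dim_row B, j mod dim_col B))"

text \<open>Finite sums of matrices; the dimensions are explicit since matrices of all dimensions share
  one type.\<close>
definition sum_mat :: "nat \<Rightarrow> nat \<Rightarrow> (nat \<Rightarrow> complex mat) \<Rightarrow> nat set \<Rightarrow> complex mat" where
  "sum_mat r k f I = mat r k (\<lambda>ij. \<Sum>x\<in>I. f x $$ ij)"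

definition l2_norm :: "complex vec \<Rightarrow> real" where
  "l2_norm v = sqrt (\<Sum>i<dim_vec v. (cmod (v $ i))\<^sup>2)"

definition op_norm :: "complex mat \<Rightarrow> real" where
  "op_norm A = Sup {l2_norm (A *\<^sub>v v) | v. v \<in> carrier_vec (dim_col A) \<and> l2_norm v \<le> 1}"

text \<open>The computational basis state with number \<open>k\<close> on \<open>t\<close> qubits, as a column.\<close>
definition ket :: "nat \<Rightarrow> nat \<Rightarrow> complex mat" where
  "ket t k = mat (2 ^ t) 1 (\<lambda>(i, j). if i = k then 1 else 0)"

section \<open>Fermionic Fock space\<close>

text \<open>Fock space on the spin-orbitals \<open>{..<n}\<close>, in the occupation-number basis: basis vector \<open>i < 2 ^ n\<close>
  has orbital \<open>p\<close> occupied iff bit \<open>p\<close> of \<open>i\<close> is set. Reading bit \<open>p\<close> as the qubit of orbital \<open>p\<close>,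
  these operators are the Jordan--Wigner strings.\<close>
definition annihilation :: "nat \<Rightarrow> nat \<Rightarrow> complex mat" where
  "annihilation n p = mat (2 ^ n) (2 ^ n)
     (\<lambda>(i, j). if bit j p \<and> i = unset_bit p j then (-1) ^ card {q. q < p \<and> bit j q} else 0)"

definition creation :: "nat \<Rightarrow> nat \<Rightarrow> complex mat" where
  "creation n p = mat_adjoint (annihilation n p)"

definition sector_projector :: "nat \<Rightarrow> nat \<Rightarrow> complex mat" where
  "sector_projector n N = mat_diag (2 ^ n) (\<lambda>i. if card {p. p < n \<and> bit i p} = N then 1 else 0)"

definition rotated_creation :: "nat \<Rightarrow> complex mat \<Rightarrow> nat \<Rightarrow> complex mat" where
  "rotated_creation n U \<xi> = sum_mat (2 ^ n) (2 ^ n) (\<lambda>p. (U $$ (p, \<xi>)) \<cdot>\<^sub>m creation n p) {..<n}"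

definition mode_occupation :: "nat \<Rightarrow> complex mat \<Rightarrow> nat \<Rightarrow> complex mat" where
  "mode_occupation n U \<xi> = rotated_creation n U \<xi> * mat_adjoint (rotated_creation n U \<xi>)"

text \<open>The eigenmodes are numbered from 0, so the retained ones are \<open>\<xi> < R\<close>.\<close>
definition weighted_occupation :: "nat \<Rightarrow> nat \<Rightarrow> complex mat \<Rightarrow> (nat \<Rightarrow> real) \<Rightarrow> complex mat" where
  "weighted_occupation n R U lam =
     sum_mat (2 ^ n) (2 ^ n) (\<lambda>\<xi>. complex_of_real (lam \<xi>) \<cdot>\<^sub>m mode_occupation n U \<xi>) {..<R}"

definition weight_norm :: "nat \<Rightarrow> (nat \<Rightarrow> real) \<Rightarrow> real" where
  "weight_norm R lam = (\<Sum>\<xi><R. \<bar>lam \<xi>\<bar>)"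

text \<open>An identification of Fock space with the \<open>n\<close>-qubit system is a unitary \<open>V\<close>; it carries an operator
  \<open>X\<close> on Fock space to the following operator on qubits. Jordan--Wigner is \<open>V = 1\<close>.\<close>
definition on_qubits :: "complex mat \<Rightarrow> complex mat \<Rightarrow> complex mat" where
  "on_qubits V X = V * X * mat_adjoint V"

section \<open>Block encodings\<close>

text \<open>Registers are ordered with the ancillas to the left of the system; this is the operator
  \<open>(\<langle>0\<^sup>t| \<otimes> I) W (|0\<^sup>t\<rangle> \<otimes> I)\<close>.\<close>
definition encoded_block :: "nat \<Rightarrow> nat \<Rightarrow> complex mat \<Rightarrow> complex mat" where
  "encoded_block n t W =
     mat_adjoint (ket t 0 \<otimes>\<^sub>m 1\<^sub>m (2 ^ n)) * W * (ket t 0 \<otimes>\<^sub>m 1\<^sub>m (2 ^ n))"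

text \<open>\<open>P\<close> is the orthogonal projector onto the working subspace.\<close>
definition block_encoding ::
  "complex mat \<Rightarrow> nat \<Rightarrow> real \<Rightarrow> nat \<Rightarrow> real \<Rightarrow> complex mat \<Rightarrow> complex mat \<Rightarrow> bool" where
  "block_encoding P n \<alpha> t \<epsilon> W A \<longleftrightarrow>
     \<alpha> > 0 \<and> \<epsilon> \<ge> 0 \<and> unitary_mat (2 ^ t * 2 ^ n) W \<and> A \<in> carrier_mat (2 ^ n) (2 ^ n) \<and>
     op_norm (P * (encoded_block n t W - complex_of_real (1 / \<alpha>) \<cdot>\<^sub>m A) * P) \<le> \<epsilon>"

section \<open>PREP and SELECT\<close>

datatype index_register = Binary | Unary

fun index_qubits :: "index_register \<Rightarrow> nat \<Rightarrow> nat" where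
  "index_qubits Binary R = nat \<lceil>log 2 (real R)\<rceil>"
| "index_qubits Unary R = R"

text \<open>\<open>c \<xi>\<close> is the number of the basis state that serves as \<open>|\<xi>\<rangle>\<close>; the one-hot states are those
  numbered by powers of two.\<close>
definition index_labelling :: "index_register \<Rightarrow> nat \<Rightarrow> (nat \<Rightarrow> nat) \<Rightarrow> bool" where
  "index_labelling reg R c \<longleftrightarrow> inj_on c {..<R} \<and>
     (\<forall>\<xi><R. case reg of Binary \<Rightarrow> c \<xi> < 2 ^ index_qubits Binary R
                      | Unary \<Rightarrow> (\<exists>j<R. c \<xi> = 2 ^ j))"

definition branch_sign :: "real \<Rightarrow> complex" where
  "branch_sign x = (if x < 0 then -1 else 1)"

definition is_prep ::
  "nat \<Rightarrow> (nat \<Rightarrow> nat) \<Rightarrow> nat \<Rightarrow> (nat \<Rightarrow> real) \<Rightarrow> complex mat \<Rightarrow> bool" where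
  "is_prep a c R lam PREP \<longleftrightarrow> unitary_mat (2 ^ a) PREP \<and>
     PREP * ket a 0 = complex_of_real (1 / sqrt (weight_norm R lam)) \<cdot>\<^sub>m
       sum_mat (2 ^ a) 1 (\<lambda>\<xi>. complex_of_real (sqrt \<bar>lam \<xi>\<bar>) \<cdot>\<^sub>m ket a (c \<xi>)) {..<R}"

text \<open>Registers: index (\<open>a\<close> qubits), flag, system.\<close>
definition is_select ::
  "nat \<Rightarrow> nat \<Rightarrow> (nat \<Rightarrow> nat) \<Rightarrow> nat \<Rightarrow> (nat \<Rightarrow> real) \<Rightarrow> (nat \<Rightarrow> complex mat) \<Rightarrow> complex mat \<Rightarrow> bool"
where
  "is_select n a c R lam W SELECT \<longleftrightarrow> unitary_mat (2 ^ a * (2 * 2 ^ n)) SELECT \<and>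
     (\<forall>\<xi><R. SELECT * (ket a (c \<xi>) \<otimes>\<^sub>m 1\<^sub>m (2 * 2 ^ n)) =
              ket a (c \<xi>) \<otimes>\<^sub>m (branch_sign (lam \<xi>) \<cdot>\<^sub>m W \<xi>)) \<and>
     (\<forall>k<2 ^ a. k \<notin> c ` {..<R} \<longrightarrow>
              SELECT * (ket a k \<otimes>\<^sub>m 1\<^sub>m (2 * 2 ^ n)) = ket a k \<otimes>\<^sub>m 1\<^sub>m (2 * 2 ^ n))"

definition prep_select_prep :: "nat \<Rightarrow> complex mat \<Rightarrow> complex mat \<Rightarrow> complex mat" where
  "prep_select_prep n PREP SELECT =
     (mat_adjoint PREP \<otimes>\<^sub>m 1\<^sub>m (2 * 2 ^ n)) * SELECT * (PREP \<otimes>\<^sub>m 1\<^sub>m (2 * 2 ^ n))"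

text \<open>The block encoded by the flag-qubit unitary \<open>W\<close> does not lead out of the working subspace. A block
  encoding is constrained only between vectors of the working subspace, so this is not automatic;
  without it the square of the encoded block need not agree with the square of the encoded operator.\<close>
definition no_leakage :: "complex mat \<Rightarrow> nat \<Rightarrow> complex mat \<Rightarrow> bool" where
  "no_leakage P n W \<longleftrightarrow> encoded_block n 1 W * P = P * encoded_block n 1 W * P"

section \<open>Degree-2 QSVT circuits\<close>

text \<open>The gates act on the signal qubit together with the \<open>t\<close> ancillas of \<open>U\<close>; the signal qubit is
  the leftmost register. The flags choose between \<open>U\<close> and its adjoint.\<close>
datatype qsvt2 = QSVT2 (first_dagger: bool) (second_dagger: bool)
  (gate0: "complex mat") (gate1: "complex mat") (gate2: "complex mat")

definition qsvt2_wf :: "nat \<Rightarrow> qsvt2 \<Rightarrow> bool" where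
  "qsvt2_wf t C \<longleftrightarrow> unitary_mat (2 ^ (t + 1)) (gate0 C) \<and>
     unitary_mat (2 ^ (t + 1)) (gate1 C) \<and> unitary_mat (2 ^ (t + 1)) (gate2 C)"

definition qsvt2_apply :: "nat \<Rightarrow> qsvt2 \<Rightarrow> complex mat \<Rightarrow> complex mat" where
  "qsvt2_apply n C U =
     (gate2 C \<otimes>\<^sub>m 1\<^sub>m (2 ^ n)) *
     (1\<^sub>m 2 \<otimes>\<^sub>m (if second_dagger C then mat_adjoint U else U)) *
     (gate1 C \<otimes>\<^sub>m 1\<^sub>m (2 ^ n)) *
     (1\<^sub>m 2 \<otimes>\<^sub>m (if first_dagger C then mat_adjoint U else U)) *
     (gate0 C \<otimes>\<^sub>m 1\<^sub>m (2 ^ n))"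

text \<open>The circuit implements \<open>x \<mapsto> x\<^sup>2\<close>: every Hermitian block is replaced by its square.\<close>
definition qsvt2_implements_square :: "nat \<Rightarrow> nat \<Rightarrow> qsvt2 \<Rightarrow> bool" where
  "qsvt2_implements_square n t C \<longleftrightarrow>
     (\<forall>U. unitary_mat (2 ^ t * 2 ^ n) U \<and> hermitian_mat (2 ^ n) (encoded_block n t U) \<longrightarrow>
        encoded_block n (t + 1) (qsvt2_apply n C U) = encoded_block n t U * encoded_block n t U)"

end

theory Submission
  imports Defs "HOL-Analysis.L2_Norm"
begin

text \<open>Write \<open>A\<close> for the block of \<open>U\<close>. The circuit applies \<open>U\<close>, then the reflection
  \<open>1 - 2 |+\<rangle>\<langle>+| \<otimes> (1 - |0\<^sup>t\<rangle>\<langle>0\<^sup>t|)\<close> on signal and ancillas, then \<open>U\<^sup>\<dagger>\<close>. Since \<open>\<langle>0|+\<rangle>\<langle>+|0\<rangle> = 1/2\<close>,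
  its block is \<open>1 - (1 - A\<^sup>\<dagger> A) = A\<^sup>\<dagger> A\<close>, for every unitary \<open>U\<close>. The order \<open>U\<^sup>\<dagger> \<cdots> U\<close> matters: absence of
  leakage means that \<open>A\<close> maps the sector into itself, which makes \<open>P A\<^sup>\<dagger> A P = (P A P)\<^sup>\<dagger> (P A P)\<close>,
  whereas \<open>A A\<^sup>\<dagger>\<close> could leave the sector. With \<open>P A P = P O P / \<Gamma>\<close>, where the Hermitian \<open>O\<close> commutes with \<open>P\<close>,
  this is \<open>P O\<^sup>2 P / \<Gamma>\<^sup>2\<close>.

  The canonical anticommutation relations are checked on the Jordan--Wigner matrices, which have at
  most one nonzero entry per column, and pass to the rotated modes because \<open>U\<close> is unitary; they make
  the mode occupations commuting projectors.\<close>

section \<open>Adjoints, Kronecker products and basis kets\<close>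

text \<open>One reflection is used twice: \<open>flag_reflection\<close>, taken over the all-zero
  ancilla projector, is the middle gate of the circuit; taken over an occupation projector, it is a
  flag-qubit block encoding of that projector. Both uses follow from a single compression identity
  with an arbitrary matrix \<open>B\<close> on the outside.

  The generality of the \<open>W \<xi>\<close> shapes the argument. They are prescribed only between
  vectors of one sector, so the block of PREP, SELECT and the adjoint of PREP need not be Hermitian
  on the whole Fock space, and the squaring property for Hermitian blocks cannot be applied to it.
  Hence the circuit's block is computed for every unitary, and the sector enters only afterwards.

  Since the error is zero, the operator norm serves only to turn a block encoding into a matrix
  equation; the rest is algebra. Matrices of all dimensions share one type, so associativity and
  distributivity hold under dimension conditions only, which accounts for the many carrier facts and
  instantiated rules.\<close>

lemma dim_mat_adjoint [simp]:
  "dim_row (mat_adjoint A) = dim_col A" "dim_col (mat_adjoint A) = dim_row A"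
  by (simp_all add: mat_adjoint_def)

lemma index_mat_adjoint [simp]:
  fixes A :: "complex mat"
  assumes "i < dim_col A" "j < dim_row A"
  shows "mat_adjoint A $$ (i, j) = cnj (A $$ (j, i))"
  using assms by (simp add: mat_adjoint_def mat_of_rows_index)

lemma mat_adjoint_carrier [simp]: "mat_adjoint A \<in> carrier_mat c r \<longleftrightarrow> A \<in> carrier_mat r c"
  by (metis carrier_matD carrier_matI dim_mat_adjoint)

lemma mat_adjoint_adjoint [simp]: "mat_adjoint (mat_adjoint A) = (A :: complex mat)"
  by (rule eq_matI) auto

lemma mat_adjoint_mult:
  fixes A B :: "complex mat"
  assumes "dim_col A = dim_row B"
  shows "mat_adjoint (A * B) = mat_adjoint B * mat_adjoint A"
  using assms by (intro eq_matI) (auto simp: scalar_prod_def ac_simps)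

lemma mat_adjoint_one [simp]: "mat_adjoint (1\<^sub>m d :: complex mat) = 1\<^sub>m d"
  by (rule eq_matI) auto

lemma mat_adjoint_zero: "mat_adjoint (0\<^sub>m r c :: complex mat) = 0\<^sub>m c r"
  by (rule eq_matI) auto

lemma mat_adjoint_add:
  fixes A B :: "complex mat"
  assumes "A \<in> carrier_mat r c" "B \<in> carrier_mat r c"
  shows "mat_adjoint (A + B) = mat_adjoint A + mat_adjoint B"
  using assms by (intro eq_matI) auto

lemma mat_adjoint_minus:
  fixes A B :: "complex mat"
  assumes "A \<in> carrier_mat r c" "B \<in> carrier_mat r c"
  shows "mat_adjoint (A - B) = mat_adjoint A - mat_adjoint B"
  using assms by (intro eq_matI) auto

lemma mat_adjoint_smult [simp]: "mat_adjoint (k \<cdot>\<^sub>m A) = cnj k \<cdot>\<^sub>m mat_adjoint A" for A :: "complex mat"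
  by (rule eq_matI) auto

lemma one_smult_mat: "1 \<cdot>\<^sub>m A = A" for A :: "complex mat"
  by (rule eq_matI) auto

lemma smult_smult_mat: "a \<cdot>\<^sub>m (b \<cdot>\<^sub>m A) = (a * b) \<cdot>\<^sub>m A" for A :: "'a :: semigroup_mult mat"
  by (rule eq_matI) (auto simp: mult.assoc)

lemma unitary_matD:
  assumes "unitary_mat d A"
  shows "A \<in> carrier_mat d d" "mat_adjoint A * A = 1\<^sub>m d" "A * mat_adjoint A = 1\<^sub>m d"
  using assms by (auto simp: unitary_mat_def)

lemma unitary_mat_one: "unitary_mat d (1\<^sub>m d)"
  by (simp add: unitary_mat_def)

lemma unitary_mat_adjoint: "unitary_mat d A \<Longrightarrow> unitary_mat d (mat_adjoint A)"
  by (simp add: unitary_mat_def)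

text \<open>Stated for a rectangular isometry \<open>A\<close>, so that it cancels kets as well as
  unitaries.\<close>

lemma adjoint_mult_cancel:
  fixes A B :: "complex mat"
  assumes "mat_adjoint A * A = 1\<^sub>m d" "A \<in> carrier_mat r d" "B \<in> carrier_mat d c"
  shows "mat_adjoint A * (A * B) = B"
proof -
  have "mat_adjoint A * (A * B) = mat_adjoint A * A * B"
    using assms by (intro assoc_mult_mat[symmetric]) auto
  then show ?thesis using assms by simp
qed

lemma unitary_mat_mult:
  assumes A: "unitary_mat d A" and B: "unitary_mat d B"
  shows "unitary_mat d (A * B)"
proof -
  note cA = unitary_matD[OF A] and cB = unitary_matD[OF B]
  have cA': "mat_adjoint A \<in> carrier_mat d d" and cB': "mat_adjoint B \<in> carrier_mat d d"
    using cA cB by auto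
  have "mat_adjoint (A * B) * (A * B) = mat_adjoint B * (mat_adjoint A * (A * B))"
    using cA cB cA' cB' by (simp add: mat_adjoint_mult assoc_mult_mat[of _ d d _ d _ d])
  also have "\<dots> = 1\<^sub>m d"
    using cA cB by (simp add: adjoint_mult_cancel)
  finally have 1: "mat_adjoint (A * B) * (A * B) = 1\<^sub>m d" .
  have "(A * B) * mat_adjoint (A * B) = A * (B * (mat_adjoint B * mat_adjoint A))"
    using cA cB cA' cB' by (simp add: mat_adjoint_mult assoc_mult_mat[of _ d d _ d _ d])
  also have "\<dots> = 1\<^sub>m d"
    using adjoint_mult_cancel[of "mat_adjoint B" d d "mat_adjoint A" d] cA cB by simp
  finally show ?thesis using 1 cA cB by (simp add: unitary_mat_def)
qed

lemma unitary_if_hermitian_involution: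
  assumes "hermitian_mat d A" "A * A = 1\<^sub>m d"
  shows "unitary_mat d A"
  using assms by (simp add: unitary_mat_def hermitian_mat_def)

text \<open>The square of \<open>1 - 2 Q\<close> is \<open>1 - 4 Q + 4 Q Q\<close>. The middle gate
  of the circuit, the flag-qubit unitaries and PREP are all obtained from such reflections.\<close>

lemma hermitian_idempotent_reflection:
  assumes Q: "hermitian_mat d Q" and idem: "Q * Q = Q"
  shows "unitary_mat d (1\<^sub>m d - (2 :: complex) \<cdot>\<^sub>m Q)"
proof (rule unitary_if_hermitian_involution)
  have c: "Q \<in> carrier_mat d d" and h: "mat_adjoint Q = Q" using Q by (auto simp: hermitian_mat_def)
  let ?S = "2 \<cdot>\<^sub>m Q"
  have S: "?S \<in> carrier_mat d d" using c by simp
  show "hermitian_mat d (1\<^sub>m d - ?S)"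
    using c h by (auto simp: hermitian_mat_def mat_adjoint_minus[of _ d d] intro!: minus_carrier_mat)
  have SS: "?S * ?S = (4 :: complex) \<cdot>\<^sub>m Q"
    using c idem by (simp add: mult_smult_assoc_mat[of _ d d _ d] mult_smult_distrib[of _ d d _ d])
      (rule eq_matI, auto)
  have "(1\<^sub>m d - ?S) * (1\<^sub>m d - ?S) = (1\<^sub>m d - ?S) - (?S - ?S * ?S)"
    using S by (simp add: minus_mult_distrib_mat[of _ d d _ _ d] mult_minus_distrib_mat[of _ d d _ d] minus_carrier_mat
        left_mult_one_mat[of _ d d] right_mult_one_mat[of _ d d])
  also have "\<dots> = 1\<^sub>m d" unfolding SS using c by (intro eq_matI) auto
  finally show "(1\<^sub>m d - ?S) * (1\<^sub>m d - ?S) = 1\<^sub>m d" .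
qed

section \<open>Kronecker products\<close>

lemma dim_tensor_mat [simp]:
  "dim_row (A \<otimes>\<^sub>m B) = dim_row A * dim_row B" "dim_col (A \<otimes>\<^sub>m B) = dim_col A * dim_col B"
  by (simp_all add: tensor_mat_def)

lemma index_tensor_mat [simp]:
  assumes "i < dim_row A * dim_row B" "j < dim_col A * dim_col B"
  shows "(A \<otimes>\<^sub>m B) $$ (i, j)
    = A $$ (i div dim_row B, j div dim_col B) * B $$ (i mod dim_row B, j mod dim_col B)"
  using assms by (simp add: tensor_mat_def)

lemma tensor_mat_carrier [simp]:
  assumes "A \<in> carrier_mat r c" "B \<in> carrier_mat r' c'"
  shows "A \<otimes>\<^sub>m B \<in> carrier_mat (r * r') (c * c')"
  using assms by (intro carrier_matI) auto

lemma div_less_times: "i < a * b \<Longrightarrow> i div b < (a :: nat)" 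
  by (simp add: less_mult_imp_div_less)

lemma mod_less_times: "i < a * b \<Longrightarrow> i mod b < (b :: nat)"
  by (cases "b = 0") auto

lemma sum_lessThan_add:
  fixes f :: "nat \<Rightarrow> 'a :: comm_monoid_add"
  shows "(\<Sum>k<m + b. f k) = (\<Sum>k<m. f k) + (\<Sum>y<b. f (m + y))"
  by (induction b) (simp_all add: add.assoc)

text \<open>Every \<open>k < a * b\<close> is \<open>x * b + y\<close> for exactly one pair
  \<open>x < a\<close>, \<open>y < b\<close>: the numbering of a pair of registers.\<close>

lemma sum_lessThan_times:
  fixes f :: "nat \<Rightarrow> 'a :: comm_monoid_add"
  shows "(\<Sum>k<a * b. f k) = (\<Sum>x<a. \<Sum>y<b. f (x * b + y))"
proof (induction a)
  case (Suc a)
  have "(\<Sum>k<Suc a * b. f k) = (\<Sum>k<a * b + b. f k)" by (simp add: add.commute)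
  also have "\<dots> = (\<Sum>k<a * b. f k) + (\<Sum>y<b. f (a * b + y))"
    by (rule sum_lessThan_add)
  finally show ?case using Suc by simp
qed simp

text \<open>Once the summation index is split into its two digits, the summand separates and the sum
  becomes a product of two sums. The computations on separate registers rest on this mixed-product
  rule.\<close>

lemma tensor_mat_mult:
  fixes A B C D :: "complex mat"
  assumes AC: "dim_col A = dim_row C" and BD: "dim_col B = dim_row D"
  shows "(A \<otimes>\<^sub>m B) * (C \<otimes>\<^sub>m D) = (A * C) \<otimes>\<^sub>m (B * D)"
proof (rule eq_matI)
  fix i j
  assume "i < dim_row ((A * C) \<otimes>\<^sub>m (B * D))" "j < dim_col ((A * C) \<otimes>\<^sub>m (B * D))"
  then have i: "i < dim_row A * dim_row B" and j: "j < dim_col C * dim_col D" by auto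
  note lt = div_less_times[OF i] mod_less_times[OF i] div_less_times[OF j] mod_less_times[OF j]
  let ?a = "dim_row C" and ?b = "dim_row D"
  have "((A \<otimes>\<^sub>m B) * (C \<otimes>\<^sub>m D)) $$ (i, j)
      = (\<Sum>k<?a * ?b. A $$ (i div dim_row B, k div ?b) * B $$ (i mod dim_row B, k mod ?b)
          * (C $$ (k div ?b, j div dim_col D) * D $$ (k mod ?b, j mod dim_col D)))"
    using i j AC BD by (simp add: scalar_prod_def atLeast0LessThan)
  also have "\<dots> = (\<Sum>x<?a. \<Sum>y<?b. (A $$ (i div dim_row B, x) * C $$ (x, j div dim_col D))
          * (B $$ (i mod dim_row B, y) * D $$ (y, j mod dim_col D)))"
    unfolding sum_lessThan_times by (intro sum.cong refl) (simp add: ac_simps)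
  also have "\<dots> = (\<Sum>x<?a. A $$ (i div dim_row B, x) * C $$ (x, j div dim_col D))
          * (\<Sum>y<?b. B $$ (i mod dim_row B, y) * D $$ (y, j mod dim_col D))"
    by (simp add: sum_product)
  also have "\<dots> = ((A * C) \<otimes>\<^sub>m (B * D)) $$ (i, j)"
    using i j lt AC BD by (simp add: scalar_prod_def atLeast0LessThan)
  finally show "((A \<otimes>\<^sub>m B) * (C \<otimes>\<^sub>m D)) $$ (i, j) = ((A * C) \<otimes>\<^sub>m (B * D)) $$ (i, j)" .
qed auto

lemma mat_adjoint_tensor: "mat_adjoint (A \<otimes>\<^sub>m B) = mat_adjoint A \<otimes>\<^sub>m mat_adjoint B" for A B :: "complex mat"
  by (rule eq_matI) (auto simp: div_less_times mod_less_times)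

lemma tensor_mat_one: "1\<^sub>m a \<otimes>\<^sub>m 1\<^sub>m b = (1\<^sub>m (a * b) :: complex mat)"
proof (rule eq_matI)
  fix i j assume "i < dim_row (1\<^sub>m (a * b) :: complex mat)" "j < dim_col (1\<^sub>m (a * b) :: complex mat)"
  then have i: "i < a * b" and j: "j < a * b" by auto
  have "i div b = j div b \<and> i mod b = j mod b \<longleftrightarrow> i = j"
    by (metis div_mult_mod_eq)
  then show "(1\<^sub>m a \<otimes>\<^sub>m 1\<^sub>m b) $$ (i, j) = (1\<^sub>m (a * b) :: complex mat) $$ (i, j)"
    using i j div_less_times[OF i] mod_less_times[OF i] div_less_times[OF j] mod_less_times[OF j] by auto
qed auto

lemma tensor_mat_assoc: "(A \<otimes>\<^sub>m B) \<otimes>\<^sub>m C = A \<otimes>\<^sub>m B \<otimes>\<^sub>m C"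
proof (rule eq_matI)
  fix i j
  assume "i < dim_row (A \<otimes>\<^sub>m B \<otimes>\<^sub>m C)" "j < dim_col (A \<otimes>\<^sub>m B \<otimes>\<^sub>m C)"
  then have i: "i < dim_row A * dim_row B * dim_row C" and j: "j < dim_col A * dim_col B * dim_col C"
    by (auto simp: ac_simps)
  have i': "i < dim_row A * (dim_row B * dim_row C)" and j': "j < dim_col A * (dim_col B * dim_col C)"
    using i j by (auto simp: ac_simps)
  \<comment> \<open>Either bracketing reads off the same high, middle and low digit of an index in
    mixed radix; these identities match the digits.\<close>
  have *: "x mod (b * c) div c = x div c mod b" for x b c :: nat
    by (cases "c = 0") (simp_all add: mod_mult2_eq mult.commute[of b c])
  have **: "x mod (b * c) mod c = x mod c" for x b c :: nat
    by (simp add: mod_mult2_eq mult.commute[of b c])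
  have ***: "x div (b * c) = x div c div b" for x b c :: nat
    by (simp add: div_mult2_eq mult.commute[of b c])
  show "((A \<otimes>\<^sub>m B) \<otimes>\<^sub>m C) $$ (i, j) = (A \<otimes>\<^sub>m B \<otimes>\<^sub>m C) $$ (i, j)"
    using i j i' j' div_less_times[OF i] div_less_times[OF j] mod_less_times[OF i'] mod_less_times[OF j']
    by (simp add: * ** *** mult.assoc)
qed (auto simp: ac_simps)

lemma tensor_mat_minus_left:
  assumes "B \<in> carrier_mat r c" "C \<in> carrier_mat r c"
  shows "(B - C) \<otimes>\<^sub>m A = B \<otimes>\<^sub>m A - C \<otimes>\<^sub>m A"
  using assms by (intro eq_matI) (auto simp: algebra_simps div_less_times)

lemma tensor_mat_smult_left: "(k \<cdot>\<^sub>m A) \<otimes>\<^sub>m B = k \<cdot>\<^sub>m (A \<otimes>\<^sub>m B)"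
  by (rule eq_matI) (auto simp: div_less_times)

section \<open>Computational basis kets\<close>

lemma dim_ket [simp]: "dim_row (ket t k) = 2 ^ t" "dim_col (ket t k) = 1"
  by (simp_all add: ket_def)

lemma ket_carrier [simp]: "ket t k \<in> carrier_mat (2 ^ t) 1"
  by (simp add: ket_def)

lemma index_ket [simp]: "i < 2 ^ t \<Longrightarrow> j < 1 \<Longrightarrow> ket t k $$ (i, j) = (if i = k then 1 else 0)"
  by (simp add: ket_def)

lemma sum_eq_single:
  assumes "finite I" "k \<in> I" "\<And>x. x \<in> I \<Longrightarrow> x \<noteq> k \<Longrightarrow> f x = 0"
  shows "sum f I = f k"
  using assms by (simp add: sum.remove[of I k])

lemma mult_ket:
  assumes "A \<in> carrier_mat r (2 ^ t)" "k < 2 ^ t"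
  shows "A * ket t k = mat r 1 (\<lambda>(i, j). A $$ (i, k))"
proof (rule eq_matI)
  fix i j assume "i < dim_row (mat r 1 (\<lambda>(i, j). A $$ (i, k)))" "j < dim_col (mat r 1 (\<lambda>(i, j). A $$ (i, k)))"
  then have ij: "i < r" "j = 0" by auto
  have "(A * ket t k) $$ (i, j) = (\<Sum>x\<in>{0..<2 ^ t}. A $$ (i, x) * ket t k $$ (x, j))"
    using assms ij by (simp add: scalar_prod_def)
  also have "\<dots> = A $$ (i, k) * ket t k $$ (k, j)"
    using assms ij by (intro sum_eq_single) auto
  finally show "(A * ket t k) $$ (i, j) = mat r 1 (\<lambda>(i, j). A $$ (i, k)) $$ (i, j)"
    using assms ij by simp
qed (use assms in auto)

lemma ket_inner:
  assumes "k < 2 ^ t" "l < 2 ^ t"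
  shows "mat_adjoint (ket t k) * ket t l = (if k = l then 1\<^sub>m 1 else 0\<^sub>m 1 1)"
  using assms by (subst mult_ket[of _ 1]) (auto intro!: eq_matI)

text \<open>A number is zero iff both of its digits in radix \<open>2 ^ t\<close> are, so an
  all-zero ancilla register can be split into smaller ones.\<close>

lemma ket_add_zero: "ket (s + t) 0 = ket s 0 \<otimes>\<^sub>m ket t 0"
proof (rule eq_matI)
  fix i j assume "i < dim_row (ket s 0 \<otimes>\<^sub>m ket t 0)" "j < dim_col (ket s 0 \<otimes>\<^sub>m ket t 0)"
  then have i: "i < 2 ^ s * 2 ^ t" and j: "j = 0" by auto
  have "i = 0 \<longleftrightarrow> i div 2 ^ t = 0 \<and> i mod 2 ^ t = 0"
    by (metis div_0 mod_0 div_mult_mod_eq add.right_neutral mult_0)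
  then show "ket (s + t) 0 $$ (i, j) = (ket s 0 \<otimes>\<^sub>m ket t 0) $$ (i, j)"
    using i j div_less_times[OF i] mod_less_times[OF i] by (auto simp: power_add)
qed (auto simp: power_add)

section \<open>Exact block encodings\<close>

lemma dim_sum_mat [simp]: "dim_row (sum_mat r k f I) = r" "dim_col (sum_mat r k f I) = k"
  by (simp_all add: sum_mat_def)

lemma sum_mat_carrier [simp]: "sum_mat r k f I \<in> carrier_mat r k"
  by (simp add: sum_mat_def)

lemma index_sum_mat [simp]:
  "i < r \<Longrightarrow> j < k \<Longrightarrow> sum_mat r k f I $$ (i, j) = (\<Sum>x\<in>I. f x $$ (i, j))"
  by (simp add: sum_mat_def)

lemma sum_mat_cong:
  assumes "\<And>x. x \<in> I \<Longrightarrow> f x = g x"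
  shows "sum_mat r k f I = sum_mat r k g I"
  using assms by (simp add: sum_mat_def)

lemma mult_sum_mat:
  assumes "A \<in> carrier_mat s r" "\<And>x. x \<in> I \<Longrightarrow> f x \<in> carrier_mat r k"
  shows "A * sum_mat r k f I = sum_mat s k (\<lambda>x. A * f x) I"
proof (rule eq_matI)
  fix i j assume "i < dim_row (sum_mat s k (\<lambda>x. A * f x) I)" "j < dim_col (sum_mat s k (\<lambda>x. A * f x) I)"
  then have ij: "i < s" "j < k" by auto
  have "(A * sum_mat r k f I) $$ (i, j) = (\<Sum>l\<in>{0..<r}. \<Sum>x\<in>I. A $$ (i, l) * f x $$ (l, j))"
    using assms(1) ij by (simp add: scalar_prod_def sum_distrib_left)
  also have "\<dots> = (\<Sum>x\<in>I. \<Sum>l\<in>{0..<r}. A $$ (i, l) * f x $$ (l, j))"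
    by (rule sum.swap)
  also have "\<dots> = (\<Sum>x\<in>I. (A * f x) $$ (i, j))"
  proof (rule sum.cong)
    fix x assume "x \<in> I"
    then have "f x \<in> carrier_mat r k" by (rule assms(2))
    then show "(\<Sum>l\<in>{0..<r}. A $$ (i, l) * f x $$ (l, j)) = (A * f x) $$ (i, j)"
      using assms(1) ij by (simp add: scalar_prod_def)
  qed simp
  finally show "(A * sum_mat r k f I) $$ (i, j) = sum_mat s k (\<lambda>x. A * f x) I $$ (i, j)"
    using ij by simp
qed (use assms in auto)

lemma mat_adjoint_sum_mat:
  assumes "\<And>x. x \<in> I \<Longrightarrow> f x \<in> carrier_mat r k"
  shows "mat_adjoint (sum_mat r k f I) = sum_mat k r (\<lambda>x. mat_adjoint (f x)) I"
proof (rule eq_matI)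
  fix i j assume "i < dim_row (sum_mat k r (\<lambda>x. mat_adjoint (f x)) I)" "j < dim_col (sum_mat k r (\<lambda>x. mat_adjoint (f x)) I)"
  then have ij: "i < k" "j < r" by auto
  have "(\<Sum>x\<in>I. cnj (f x $$ (j, i))) = (\<Sum>x\<in>I. mat_adjoint (f x) $$ (i, j))"
  proof (rule sum.cong)
    fix x assume "x \<in> I"
    then have "f x \<in> carrier_mat r k" by (rule assms)
    then show "cnj (f x $$ (j, i)) = mat_adjoint (f x) $$ (i, j)" using ij by simp
  qed simp
  then show "mat_adjoint (sum_mat r k f I) $$ (i, j) = sum_mat k r (\<lambda>x. mat_adjoint (f x)) I $$ (i, j)"
    using ij by simp
qed auto

lemma sum_mat_mult:
  assumes A: "A \<in> carrier_mat k s" and f: "\<And>x. x \<in> I \<Longrightarrow> f x \<in> carrier_mat r k"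
  shows "sum_mat r k f I * A = sum_mat r s (\<lambda>x. f x * A) I"
proof (rule eq_matI)
  fix i j assume "i < dim_row (sum_mat r s (\<lambda>x. f x * A) I)" "j < dim_col (sum_mat r s (\<lambda>x. f x * A) I)"
  then have ij: "i < r" "j < s" by auto
  have "(sum_mat r k f I * A) $$ (i, j) = (\<Sum>l\<in>{0..<k}. \<Sum>x\<in>I. f x $$ (i, l) * A $$ (l, j))"
    using A ij by (simp add: scalar_prod_def sum_distrib_right)
  also have "\<dots> = (\<Sum>x\<in>I. \<Sum>l\<in>{0..<k}. f x $$ (i, l) * A $$ (l, j))"
    by (rule sum.swap)
  also have "\<dots> = (\<Sum>x\<in>I. (f x * A) $$ (i, j))"
  proof (rule sum.cong)
    fix x assume "x \<in> I"
    then have "f x \<in> carrier_mat r k" by (rule f)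
    then show "(\<Sum>l\<in>{0..<k}. f x $$ (i, l) * A $$ (l, j)) = (f x * A) $$ (i, j)"
      using A ij by (simp add: scalar_prod_def)
  qed simp
  finally show "(sum_mat r k f I * A) $$ (i, j) = sum_mat r s (\<lambda>x. f x * A) I $$ (i, j)"
    using ij by simp
qed (use A in auto)

lemma smult_sum_mat:
  assumes "\<And>x. x \<in> I \<Longrightarrow> f x \<in> carrier_mat r k"
  shows "c \<cdot>\<^sub>m sum_mat r k f I = sum_mat r k (\<lambda>x. c \<cdot>\<^sub>m f x) I"
proof (rule eq_matI)
  fix i j assume "i < dim_row (sum_mat r k (\<lambda>x. c \<cdot>\<^sub>m f x) I)" "j < dim_col (sum_mat r k (\<lambda>x. c \<cdot>\<^sub>m f x) I)"
  then have ij: "i < r" "j < k" by auto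
  have "(\<Sum>x\<in>I. c * (f x $$ (i, j))) = (\<Sum>x\<in>I. (c \<cdot>\<^sub>m f x) $$ (i, j))"
  proof (rule sum.cong)
    fix x assume "x \<in> I"
    then have "f x \<in> carrier_mat r k" by (rule assms)
    then show "c * (f x $$ (i, j)) = (c \<cdot>\<^sub>m f x) $$ (i, j)" using ij by simp
  qed simp
  then show "(c \<cdot>\<^sub>m sum_mat r k f I) $$ (i, j) = sum_mat r k (\<lambda>x. c \<cdot>\<^sub>m f x) I $$ (i, j)"
    using ij by (simp add: sum_distrib_left)
qed auto

lemma tensor_sum_mat:
  assumes f: "\<And>x. x \<in> I \<Longrightarrow> f x \<in> carrier_mat r k" and B: "B \<in> carrier_mat r' k'"
  shows "sum_mat r k f I \<otimes>\<^sub>m B = sum_mat (r * r') (k * k') (\<lambda>x. f x \<otimes>\<^sub>m B) I"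
proof (rule eq_matI)
  fix i j
  assume "i < dim_row (sum_mat (r * r') (k * k') (\<lambda>x. f x \<otimes>\<^sub>m B) I)"
    "j < dim_col (sum_mat (r * r') (k * k') (\<lambda>x. f x \<otimes>\<^sub>m B) I)"
  then have ij: "i < r * r'" "j < k * k'" by auto
  note lt = div_less_times[OF ij(1)] div_less_times[OF ij(2)]
  have "(\<Sum>x\<in>I. f x $$ (i div r', j div k') * B $$ (i mod r', j mod k')) = (\<Sum>x\<in>I. (f x \<otimes>\<^sub>m B) $$ (i, j))"
  proof (rule sum.cong)
    fix x assume "x \<in> I"
    then have "f x \<in> carrier_mat r k" by (rule f)
    then show "f x $$ (i div r', j div k') * B $$ (i mod r', j mod k') = (f x \<otimes>\<^sub>m B) $$ (i, j)"
      using ij B by simp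
  qed simp
  then show "(sum_mat r k f I \<otimes>\<^sub>m B) $$ (i, j) = sum_mat (r * r') (k * k') (\<lambda>x. f x \<otimes>\<^sub>m B) I $$ (i, j)"
    using ij lt B by (simp add: sum_distrib_right)
qed (use B in auto)

lemma sum_mat_eq_single:
  assumes "finite I" "x \<in> I" "f x \<in> carrier_mat r k"
    and "\<And>y. y \<in> I \<Longrightarrow> y \<noteq> x \<Longrightarrow> f y = 0\<^sub>m r k"
  shows "sum_mat r k f I = f x"
  using assms by (intro eq_matI) (auto intro!: sum_eq_single)

section \<open>The operator norm and errors of size zero\<close>

lemma l2_norm_eq_L2_set: "l2_norm v = L2_set (\<lambda>i. cmod (v $ i)) {..<dim_vec v}"
  by (simp add: l2_norm_def L2_set_def)

lemma cmod_index_le_l2_norm: "i < dim_vec v \<Longrightarrow> cmod (v $ i) \<le> l2_norm v"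
  unfolding l2_norm_eq_L2_set by (rule member_le_L2_set) auto

lemma l2_norm_le_sum: "l2_norm v \<le> (\<Sum>i<dim_vec v. cmod (v $ i))"
  unfolding l2_norm_eq_L2_set by (rule L2_set_le_sum) auto

text \<open>A real \<open>Sup\<close> is an upper bound only of a set that is bounded above. The
  entries of \<open>v\<close> have modulus at most 1, so the crude bound by the sum of all moduli of
  entries of \<open>A\<close> is enough.\<close>

lemma bdd_above_op_norm:
  "bdd_above {l2_norm (A *\<^sub>v v) | v. v \<in> carrier_vec (dim_col A) \<and> l2_norm v \<le> 1}"
proof (rule bdd_aboveI)
  fix y assume "y \<in> {l2_norm (A *\<^sub>v v) | v. v \<in> carrier_vec (dim_col A) \<and> l2_norm v \<le> 1}"
  then obtain v where "v \<in> carrier_vec (dim_col A)" and v1: "l2_norm v \<le> 1" and y: "y = l2_norm (A *\<^sub>v v)"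
    by blast
  then have v: "dim_vec v = dim_col A" "l2_norm v \<le> 1" by auto
  have vj: "cmod (v $ j) \<le> 1" if "j < dim_col A" for j
    using cmod_index_le_l2_norm[of j v] v that by simp
  have "y \<le> (\<Sum>i<dim_row A. cmod ((A *\<^sub>v v) $ i))"
    unfolding y using l2_norm_le_sum[of "A *\<^sub>v v"] by simp
  also have "\<dots> \<le> (\<Sum>i<dim_row A. \<Sum>j<dim_col A. cmod (A $$ (i, j)))"
  proof (rule sum_mono)
    fix i assume "i \<in> {..<dim_row A}"
    then have "cmod ((A *\<^sub>v v) $ i) = cmod (\<Sum>j<dim_col A. A $$ (i, j) * v $ j)"
      using v by (simp add: scalar_prod_def atLeast0LessThan)
    also have "\<dots> \<le> (\<Sum>j<dim_col A. cmod (A $$ (i, j)))"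
      by (rule sum_norm_le) (use vj in \<open>auto simp: norm_mult intro!: mult_left_le\<close>)
    finally show "cmod ((A *\<^sub>v v) $ i) \<le> (\<Sum>j<dim_col A. cmod (A $$ (i, j)))" .
  qed
  finally show "y \<le> (\<Sum>i<dim_row A. \<Sum>j<dim_col A. cmod (A $$ (i, j)))" .
qed

text \<open>Unit vectors pick out the columns, so each entry of \<open>A\<close> is bounded by the
  norm.\<close>

lemma op_norm_le_zero_iff:
  assumes A: "A \<in> carrier_mat r c"
  shows "op_norm A \<le> 0 \<longleftrightarrow> A = 0\<^sub>m r c"
proof
  assume le: "op_norm A \<le> 0"
  show "A = 0\<^sub>m r c"
  proof (rule eq_matI)
    fix i j assume "i < dim_row (0\<^sub>m r c :: complex mat)" "j < dim_col (0\<^sub>m r c :: complex mat)"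
    then have ij: "i < dim_row A" "j < dim_col A" using A by auto
    have "(\<Sum>k<dim_col A. (cmod ((unit_vec (dim_col A) j :: complex vec) $ k))\<^sup>2)
        = (cmod ((unit_vec (dim_col A) j :: complex vec) $ j))\<^sup>2"
      using ij by (intro sum_eq_single) auto
    then have "l2_norm (unit_vec (dim_col A) j) = 1" using ij by (simp add: l2_norm_def)
    then have "l2_norm (A *\<^sub>v unit_vec (dim_col A) j) \<le> op_norm A"
      unfolding op_norm_def by (intro cSup_upper bdd_above_op_norm) force
    moreover have "cmod (A $$ (i, j)) = cmod ((A *\<^sub>v unit_vec (dim_col A) j) $ i)"
      using ij by simp
    moreover have "cmod ((A *\<^sub>v unit_vec (dim_col A) j) $ i) \<le> l2_norm (A *\<^sub>v unit_vec (dim_col A) j)"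
      using ij by (intro cmod_index_le_l2_norm) simp
    ultimately have "cmod (A $$ (i, j)) \<le> 0" using le by linarith
    then show "A $$ (i, j) = 0\<^sub>m r c $$ (i, j)" using ij A by simp
  qed (use A in auto)
next
  assume A0: "A = 0\<^sub>m r c"
  have zero: "l2_norm (0\<^sub>m r c *\<^sub>v v) = 0" if "v \<in> carrier_vec c" for v
    using that by (simp add: l2_norm_def scalar_prod_def)
  \<comment> \<open>The zero vector shows that the supremum is over a nonempty set, as
    \<open>cSup_least\<close> requires.\<close>
  have "l2_norm (0\<^sub>v c) \<le> 1" by (simp add: l2_norm_def)
  then show "op_norm A \<le> 0" unfolding op_norm_def A0
    by (intro cSup_least) (use zero in \<open>auto intro!: exI[of _ "0\<^sub>v c"]\<close>)
qed

lemma encoded_block_carrier [simp]: "encoded_block n t W \<in> carrier_mat (2 ^ n) (2 ^ n)"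
  unfolding encoded_block_def by (intro carrier_matI) simp_all

lemma mat_minus_eq_zero_iff:
  fixes A B :: "complex mat"
  assumes "A \<in> carrier_mat r c" "B \<in> carrier_mat r c"
  shows "A - B = 0\<^sub>m r c \<longleftrightarrow> A = B"
proof
  assume *: "A - B = 0\<^sub>m r c"
  show "A = B"
  proof (rule eq_matI)
    fix i j assume ij: "i < dim_row B" "j < dim_col B"
    then have "(A - B) $$ (i, j) = 0" using assms by (simp add: *)
    then show "A $$ (i, j) = B $$ (i, j)" using assms ij by simp
  qed (use assms in auto)
qed (use assms in simp)

text \<open>At error zero the norm condition says that the compressed difference vanishes. From here
  on block encodings are treated as equations.\<close>

lemma block_encoding_exact_iff:
  assumes P: "P \<in> carrier_mat (2 ^ n) (2 ^ n)"
  shows "block_encoding P n \<alpha> t 0 W A \<longleftrightarrow>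
    \<alpha> > 0 \<and> unitary_mat (2 ^ t * 2 ^ n) W \<and> A \<in> carrier_mat (2 ^ n) (2 ^ n) \<and>
    P * encoded_block n t W * P = complex_of_real (1 / \<alpha>) \<cdot>\<^sub>m (P * A * P)"
proof (cases "A \<in> carrier_mat (2 ^ n) (2 ^ n)")
  case A: True
  let ?d = "2 ^ n :: nat" and ?E = "encoded_block n t W" and ?k = "complex_of_real (1 / \<alpha>)"
  have E: "?E \<in> carrier_mat ?d ?d" by simp
  have kA: "?k \<cdot>\<^sub>m A \<in> carrier_mat ?d ?d" using A by simp
  have "P * (?E - ?k \<cdot>\<^sub>m A) * P = P * ?E * P - P * (?k \<cdot>\<^sub>m A) * P"
    using P E kA by (simp add: mult_minus_distrib_mat[of _ ?d ?d _ ?d] minus_mult_distrib_mat[of _ ?d ?d _ _ ?d])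
  also have "P * (?k \<cdot>\<^sub>m A) * P = ?k \<cdot>\<^sub>m (P * A * P)"
    using P A by (simp add: mult_smult_distrib[of _ ?d ?d _ ?d] mult_smult_assoc_mat[of _ ?d ?d _ ?d] del: assoc_mult_mat)
  finally have "P * (?E - ?k \<cdot>\<^sub>m A) * P = P * ?E * P - ?k \<cdot>\<^sub>m (P * A * P)" .
  moreover have "P * ?E * P \<in> carrier_mat ?d ?d" "?k \<cdot>\<^sub>m (P * A * P) \<in> carrier_mat ?d ?d"
    using P A by auto
  ultimately show ?thesis
    unfolding block_encoding_def
    using op_norm_le_zero_iff[of "P * (?E - ?k \<cdot>\<^sub>m A) * P" ?d ?d] mat_minus_eq_zero_iff[of "P * ?E * P" ?d ?d "?k \<cdot>\<^sub>m (P * A * P)"]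
    by (metis A minus_carrier_mat order_refl)
qed (simp add: block_encoding_def)

section \<open>Anticommutation relations\<close>

lemma mat_add_self_eq_zero:
  fixes A :: "complex mat"
  assumes "A \<in> carrier_mat r c" "A + A = 0\<^sub>m r c"
  shows "A = 0\<^sub>m r c"
proof (rule eq_matI)
  fix i j assume "i < dim_row (0\<^sub>m r c :: complex mat)" "j < dim_col (0\<^sub>m r c :: complex mat)"
  then have "(A + A) $$ (i, j) = 0" "i < dim_row A" "j < dim_col A" using assms by auto
  then show "A $$ (i, j) = 0\<^sub>m r c $$ (i, j)" using assms(1) by simp
qed (use assms in auto)

lemma mat_add_eq_zeroD:
  fixes A B :: "complex mat"
  assumes "A \<in> carrier_mat r c" "B \<in> carrier_mat r c" "A + B = 0\<^sub>m r c"
  shows "A = - B"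
proof (rule eq_matI)
  fix i j assume ij: "i < dim_row (- B)" "j < dim_col (- B)"
  then have "(A + B) $$ (i, j) = 0" unfolding assms(3) using assms(2) by simp
  then show "A $$ (i, j) = (- B) $$ (i, j)" using ij assms(1,2) by (simp add: add_eq_0_iff2)
qed (use assms in auto)

text \<open>Multiplying \<open>b * c + c * b = 1\<close> on the right by \<open>b\<close> kills the
  term \<open>c * b * b\<close>, because \<open>b * b = 0\<close>; what remains is
  \<open>b * c * b = b\<close>.\<close>

lemma number_operator_idempotent:
  fixes b c :: "complex mat"
  assumes b: "b \<in> carrier_mat d d" and c: "c \<in> carrier_mat d d"
    and bb: "b * b + b * b = 0\<^sub>m d d" and bc: "b * c + c * b = 1\<^sub>m d"
  shows "(c * b) * (c * b) = c * b"
proof -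
  have bb0: "b * b = 0\<^sub>m d d" by (rule mat_add_self_eq_zero[OF mult_carrier_mat[OF b b] bb])
  have cars: "b * c \<in> carrier_mat d d" "c * b \<in> carrier_mat d d"
    by (rule mult_carrier_mat[OF b c], rule mult_carrier_mat[OF c b])
  have "(b * c + c * b) * b = b * c * b + c * b * b"
    by (rule add_mult_distrib_mat[OF cars b])
  moreover have "c * b * b = 0\<^sub>m d d"
    by (simp only: assoc_mult_mat[OF c b b] bb0 right_mult_zero_mat[OF c])
  moreover have "b * c * b + 0\<^sub>m d d = b * c * b"
    by (rule right_add_zero_mat[OF mult_carrier_mat[OF cars(1) b]])
  ultimately have "b * c * b = b"
    by (simp only: bc left_mult_one_mat[OF b])
  then have "b * (c * b) = b" by (simp only: assoc_mult_mat[OF b c b])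
  then show ?thesis by (simp only: assoc_mult_mat[OF c b cars(2)])
qed

text \<open>Moving one pair past the other takes four transpositions, each with a sign -1; the signs
  cancel.\<close>

lemma number_operators_commute:
  fixes b c b' c' :: "complex mat"
  assumes car: "b \<in> carrier_mat d d" "c \<in> carrier_mat d d" "b' \<in> carrier_mat d d" "c' \<in> carrier_mat d d"
    and bb: "b * b' + b' * b = 0\<^sub>m d d" and cc: "c * c' + c' * c = 0\<^sub>m d d"
    and bc: "b * c' + c' * b = 0\<^sub>m d d" and cb: "b' * c + c * b' = 0\<^sub>m d d"
  shows "(c * b) * (c' * b') = (c' * b') * (c * b)"
proof -
  have bb': "b * b' = - (b' * b)" and cc': "c * c' = - (c' * c)" and bc': "b * c' = - (c' * b)"
    and cb': "b' * c = - (c * b')"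
    by (rule mat_add_eq_zeroD[of _ d d]; use assms in simp)+
  note as = assoc_mult_mat[of _ d d _ d _ d]
  have "(c * b) * (c' * b') = c * (b * c') * b'" using car by (simp add: as)
  also have "\<dots> = - ((c * c') * (b * b'))" unfolding bc' using car by (simp add: as)
  also have "\<dots> = - (c' * (c * b') * b)" unfolding cc' bb' using car by (simp add: as)
  also have "\<dots> = c' * (b' * c) * b" unfolding cb' using car by (simp add: as)
  finally show ?thesis using car by (simp add: as)
qed

text \<open>The anticommutator is bilinear, so scalar anticommutators of the orbitals determine
  those of their linear combinations. It is applied with \<open>h\<close> zero for two annihilators
  and with \<open>h\<close> the Kronecker delta for an annihilator and a creator.\<close>

lemma sum_mat_anticommutator:
  assumes F: "\<And>p. p \<in> I \<Longrightarrow> F p \<in> carrier_mat d d" and G: "\<And>q. q \<in> J \<Longrightarrow> G q \<in> carrier_mat d d"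
    and FG: "\<And>p q. p \<in> I \<Longrightarrow> q \<in> J \<Longrightarrow> F p * G q + G q * F p = h p q \<cdot>\<^sub>m 1\<^sub>m d"
  shows "sum_mat d d (\<lambda>p. u p \<cdot>\<^sub>m F p) I * sum_mat d d (\<lambda>q. v q \<cdot>\<^sub>m G q) J
       + sum_mat d d (\<lambda>q. v q \<cdot>\<^sub>m G q) J * sum_mat d d (\<lambda>p. u p \<cdot>\<^sub>m F p) I
       = (\<Sum>p\<in>I. \<Sum>q\<in>J. u p * v q * h p q) \<cdot>\<^sub>m 1\<^sub>m d" (is "?A * ?B + ?B * ?A = ?k \<cdot>\<^sub>m _")
proof (rule eq_matI)
  fix i j assume "i < dim_row (?k \<cdot>\<^sub>m 1\<^sub>m d)" "j < dim_col (?k \<cdot>\<^sub>m 1\<^sub>m d)"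
  then have ij: "i < d" "j < d" by auto
  have "?A * ?B = sum_mat d d (\<lambda>p. (u p \<cdot>\<^sub>m F p) * ?B) I"
    by (rule sum_mat_mult) (use F in auto)
  also have "\<dots> = sum_mat d d (\<lambda>p. sum_mat d d (\<lambda>q. (u p \<cdot>\<^sub>m F p) * (v q \<cdot>\<^sub>m G q)) J) I"
    by (intro sum_mat_cong mult_sum_mat) (use F G in auto)
  finally have AB: "(?A * ?B) $$ (i, j) = (\<Sum>p\<in>I. \<Sum>q\<in>J. ((u p \<cdot>\<^sub>m F p) * (v q \<cdot>\<^sub>m G q)) $$ (i, j))"
    using ij by simp
  have "?B * ?A = sum_mat d d (\<lambda>q. (v q \<cdot>\<^sub>m G q) * ?A) J"
    by (rule sum_mat_mult) (use G in auto)
  also have "\<dots> = sum_mat d d (\<lambda>q. sum_mat d d (\<lambda>p. (v q \<cdot>\<^sub>m G q) * (u p \<cdot>\<^sub>m F p)) I) J"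
    by (intro sum_mat_cong mult_sum_mat) (use F G in auto)
  finally have "(?B * ?A) $$ (i, j) = (\<Sum>q\<in>J. \<Sum>p\<in>I. ((v q \<cdot>\<^sub>m G q) * (u p \<cdot>\<^sub>m F p)) $$ (i, j))"
    using ij by simp
  \<comment> \<open>With the summations exchanged, the terms of the two products pair up for each
    \<open>p\<close> and \<open>q\<close>.\<close>
  also have "\<dots> = (\<Sum>p\<in>I. \<Sum>q\<in>J. ((v q \<cdot>\<^sub>m G q) * (u p \<cdot>\<^sub>m F p)) $$ (i, j))"
    by (rule sum.swap)
  finally have BA: "(?B * ?A) $$ (i, j) = \<dots>" .
  have "((u p \<cdot>\<^sub>m F p) * (v q \<cdot>\<^sub>m G q)) $$ (i, j) + ((v q \<cdot>\<^sub>m G q) * (u p \<cdot>\<^sub>m F p)) $$ (i, j)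
      = (u p * v q * h p q) * 1\<^sub>m d $$ (i, j)" if pq: "p \<in> I" "q \<in> J" for p q
  proof -
    note c = F[OF pq(1)] G[OF pq(2)]
    have *: "(u p \<cdot>\<^sub>m F p) * (v q \<cdot>\<^sub>m G q) = (u p * v q) \<cdot>\<^sub>m (F p * G q)"
         "(v q \<cdot>\<^sub>m G q) * (u p \<cdot>\<^sub>m F p) = (u p * v q) \<cdot>\<^sub>m (G q * F p)"
      using c by (simp_all add: mult_smult_assoc_mat[of _ d d _ d] mult_smult_distrib[of _ d d _ d] smult_smult_mat
          mult.commute)
    have "((u p \<cdot>\<^sub>m F p) * (v q \<cdot>\<^sub>m G q)) $$ (i, j) + ((v q \<cdot>\<^sub>m G q) * (u p \<cdot>\<^sub>m F p)) $$ (i, j)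
        = u p * v q * (F p * G q + G q * F p) $$ (i, j)"
      unfolding * using c ij by (simp add: distrib_left)
    then show ?thesis unfolding FG[OF pq] using ij by simp
  qed
  then have "(\<Sum>p\<in>I. \<Sum>q\<in>J. ((u p \<cdot>\<^sub>m F p) * (v q \<cdot>\<^sub>m G q)) $$ (i, j) + ((v q \<cdot>\<^sub>m G q) * (u p \<cdot>\<^sub>m F p)) $$ (i, j))
      = ?k * 1\<^sub>m d $$ (i, j)"
    by (simp add: sum_distrib_right)
  then show "(?A * ?B + ?B * ?A) $$ (i, j) = (?k \<cdot>\<^sub>m 1\<^sub>m d) $$ (i, j)"
    using ij AB BA by (simp add: sum.distrib)
qed auto

section \<open>Jordan-Wigner operators as weighted partial maps of basis states\<close>

text \<open>A partial map on basis states with coefficients: \<open>P\<close> is its domain,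
  \<open>f\<close> the map, \<open>s\<close> the coefficient. Products of such matrices are
  compositions, so operator identities reduce to identities about bits and signs.\<close>

definition monomial_mat :: "nat \<Rightarrow> (nat \<Rightarrow> bool) \<Rightarrow> (nat \<Rightarrow> nat) \<Rightarrow> (nat \<Rightarrow> complex) \<Rightarrow> complex mat" where
  "monomial_mat d P f s = mat d d (\<lambda>(i, j). if P j \<and> i = f j then s j else 0)"

lemma monomial_mat_carrier [simp]: "monomial_mat d P f s \<in> carrier_mat d d"
  by (simp add: monomial_mat_def)

lemma index_monomial_mat [simp]:
  "i < d \<Longrightarrow> j < d \<Longrightarrow> monomial_mat d P f s $$ (i, j) = (if P j \<and> i = f j then s j else 0)"
  by (simp add: monomial_mat_def)

lemma dim_monomial_mat [simp]: "dim_row (monomial_mat d P f s) = d" "dim_col (monomial_mat d P f s) = d"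
  by (simp_all add: monomial_mat_def)

text \<open>Only the intermediate index \<open>f' j\<close> can contribute to column
  \<open>j\<close>; the range condition ensures that it occurs in the sum.\<close>

lemma monomial_mat_mult:
  assumes "\<And>j. j < d \<Longrightarrow> P' j \<Longrightarrow> f' j < d"
  shows "monomial_mat d P f s * monomial_mat d P' f' s'
    = monomial_mat d (\<lambda>j. P' j \<and> P (f' j)) (\<lambda>j. f (f' j)) (\<lambda>j. s (f' j) * s' j)" (is "?A * ?B = ?C")
proof (rule eq_matI)
  fix i j assume "i < dim_row ?C" "j < dim_col ?C"
  then have ij: "i < d" "j < d" by auto
  have *: "(?A * ?B) $$ (i, j) = (\<Sum>k\<in>{0..<d}. ?A $$ (i, k) * ?B $$ (k, j))"
    using ij by (simp add: scalar_prod_def)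
  show "(?A * ?B) $$ (i, j) = ?C $$ (i, j)"
  proof (cases "P' j")
    case True
    have "(\<Sum>k\<in>{0..<d}. ?A $$ (i, k) * ?B $$ (k, j)) = ?A $$ (i, f' j) * ?B $$ (f' j, j)"
      using assms[OF ij(2) True] ij by (intro sum_eq_single) auto
    then show ?thesis unfolding * using assms[OF ij(2) True] ij True by simp
  next
    case False
    then show ?thesis unfolding * using ij by simp
  qed
qed auto

text \<open>The matrix form of a conservation law: \<open>g\<close> takes the same value before and
  after the map \<open>f\<close>.\<close>

lemma monomial_mat_commute_diag:
  assumes "\<And>j. j < d \<Longrightarrow> P j \<Longrightarrow> g (f j) = g j"
  shows "mat_diag d g * monomial_mat d P f s = monomial_mat d P f s * mat_diag d g"
  using assms by (auto simp: mat_diag_mult_left[of _ d d] mat_diag_mult_right[of _ d d] intro!: eq_matI)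

definition jw_sign :: "nat \<Rightarrow> nat \<Rightarrow> complex" where
  "jw_sign p j = (-1) ^ card {q. q < p \<and> bit j q}"

lemma jw_sign_mult_self: "jw_sign p j * jw_sign p j = 1"
  by (simp add: jw_sign_def flip: power_mult_distrib)

lemma cnj_jw_sign [simp]: "cnj (jw_sign p j) = jw_sign p j"
  by (simp add: jw_sign_def)

text \<open>The correction is added to the smaller count because subtraction of naturals
  truncates.\<close>

lemma card_bits_unset_bit:
  fixes j :: nat
  shows "card {q. q < p \<and> bit j q}
    = card {q. q < p \<and> bit (unset_bit r j) q} + (if r < p \<and> bit j r then 1 else 0)"
proof -
  let ?S = "{q. q < p \<and> bit j q}"
  have eq: "{q. q < p \<and> bit (unset_bit r j) q} = ?S - {r}"
    by (auto simp: bit_unset_bit_iff)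
  show ?thesis
  proof (cases "r < p \<and> bit j r")
    case True
    then have "card ?S = Suc (card (?S - {r}))" by (intro card.remove) auto
    then show ?thesis unfolding eq using True by simp
  next
    case False
    then have "?S - {r} = ?S" by auto
    then show ?thesis unfolding eq using False by simp
  qed
qed

lemma unset_set_bit: "\<not> bit j r \<Longrightarrow> unset_bit r (set_bit r j) = j" for j :: nat
  by (rule bit_eqI) (auto simp: bit_unset_bit_iff bit_set_bit_iff)

lemma set_unset_bit: "bit j r \<Longrightarrow> set_bit r (unset_bit r j) = j" for j :: nat
  by (rule bit_eqI) (auto simp: bit_unset_bit_iff bit_set_bit_iff)

lemma card_bits_set_bit:
  fixes j :: nat
  assumes "\<not> bit j r"
  shows "card {q. q < p \<and> bit (set_bit r j) q}
    = card {q. q < p \<and> bit j q} + (if r < p then 1 else 0)"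
  using card_bits_unset_bit[of p "set_bit r j" r] assms
  by (simp add: unset_set_bit bit_set_bit_iff)

text \<open>This asymmetry is the source of anticommutation: of two distinct orbitals the lower one
  lies in the sign string of the higher one but not conversely, so exchanging two operators changes
  exactly one sign.\<close>

lemma jw_sign_unset_bit:
  "jw_sign p (unset_bit r j) = (if r < p \<and> bit j r then - jw_sign p j else jw_sign p j)"
  unfolding jw_sign_def card_bits_unset_bit[of p j r] by simp

lemma jw_sign_set_bit:
  "\<not> bit j r \<Longrightarrow> jw_sign p (set_bit r j) = (if r < p then - jw_sign p j else jw_sign p j)"
  unfolding jw_sign_def by (simp add: card_bits_set_bit)

lemma bit_less_power: "p < n" if "bit j p" "j < 2 ^ n" for j :: nat
proof -
  have "take_bit n j = j" using that by (simp add: take_bit_nat_eq_self_iff)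
  then show ?thesis using that(1) by (metis bit_take_bit_iff)
qed

lemma unset_bit_less_power: "unset_bit p j < 2 ^ n" if "j < 2 ^ n" for j :: nat
proof -
  have "take_bit n (unset_bit p j) = unset_bit p j"
    using that by (auto intro!: bit_eqI simp: bit_take_bit_iff bit_unset_bit_iff dest: bit_less_power)
  then show ?thesis by (simp add: take_bit_nat_eq_self_iff)
qed

lemma set_bit_less_power: "set_bit p j < 2 ^ n" if "j < 2 ^ n" "p < n" for j :: nat
proof -
  have "take_bit n (set_bit p j) = set_bit p j"
    using that by (auto intro!: bit_eqI simp: bit_take_bit_iff bit_set_bit_iff dest: bit_less_power)
  then show ?thesis by (simp add: take_bit_nat_eq_self_iff)
qed

lemma annihilation_monomial:
  "annihilation n p = monomial_mat (2 ^ n) (\<lambda>j. bit j p) (unset_bit p) (jw_sign p)"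
  by (rule eq_matI) (auto simp: annihilation_def jw_sign_def)

text \<open>The adjoint inverts the partial map, and clearing bit \<open>p\<close> is inverse to
  setting it. The coefficient is unchanged because the string of \<open>p\<close> does not include
  \<open>p\<close> itself.\<close>

lemma creation_monomial:
  "creation n p = monomial_mat (2 ^ n) (\<lambda>j. \<not> bit j p) (set_bit p) (jw_sign p)"
proof (rule eq_matI)
  fix i j assume "i < dim_row (monomial_mat (2 ^ n) (\<lambda>j. \<not> bit j p) (set_bit p) (jw_sign p))"
    "j < dim_col (monomial_mat (2 ^ n) (\<lambda>j. \<not> bit j p) (set_bit p) (jw_sign p))"
  then have ij: "i < 2 ^ n" "j < 2 ^ n" by auto
  have "bit i p \<and> j = unset_bit p i \<longleftrightarrow> \<not> bit j p \<and> i = set_bit p j"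
    by (auto simp: unset_set_bit set_unset_bit bit_unset_bit_iff bit_set_bit_iff)
  then show "creation n p $$ (i, j) = monomial_mat (2 ^ n) (\<lambda>j. \<not> bit j p) (set_bit p) (jw_sign p) $$ (i, j)"
    using ij by (auto simp: creation_def annihilation_monomial jw_sign_set_bit)
qed (simp_all add: creation_def annihilation_monomial)

lemma annihilation_carrier [simp]: "annihilation n p \<in> carrier_mat (2 ^ n) (2 ^ n)"
  by (simp add: annihilation_monomial)

lemma creation_carrier [simp]: "creation n p \<in> carrier_mat (2 ^ n) (2 ^ n)"
  by (simp add: creation_monomial)

lemma unset_bit_commute: "unset_bit p (unset_bit q j) = unset_bit q (unset_bit p j)" for j :: nat
  by (rule bit_eqI) (auto simp: bit_unset_bit_iff)

lemma unset_set_bit_commute: "p \<noteq> q \<Longrightarrow> unset_bit p (set_bit q j) = set_bit q (unset_bit p j)" for j :: nat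
  by (rule bit_eqI) (auto simp: bit_unset_bit_iff bit_set_bit_iff)

text \<open>For \<open>p = q\<close> both products vanish, since the bit is already cleared;
  otherwise the two bit operations commute and the signs are opposite. The right-hand side has the
  shape that \<open>sum_mat_anticommutator\<close> expects.\<close>

lemma annihilation_anticommute:
  "annihilation n p * annihilation n q + annihilation n q * annihilation n p = 0 \<cdot>\<^sub>m 1\<^sub>m (2 ^ n)"
proof (cases "p = q")
  case True
  then show ?thesis unfolding annihilation_monomial
    by (intro eq_matI) (auto simp: monomial_mat_mult unset_bit_less_power bit_unset_bit_iff)
next
  case False
  then consider "p < q" | "q < p" by linarith
  then show ?thesis unfolding annihilation_monomial
    by cases (intro eq_matI; auto simp: monomial_mat_mult unset_bit_less_power bit_unset_bit_iff
      jw_sign_unset_bit unset_bit_commute[of p q] mult.commute)+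
qed

text \<open>For \<open>p = q\<close> each basis state is fixed by exactly one of the two products,
  the choice depending on its bit \<open>p\<close>, and the coefficient is a squared sign.\<close>

lemma annihilation_creation_anticommute:
  assumes "p < n" "q < n"
  shows "annihilation n p * creation n q + creation n q * annihilation n p
    = (if p = q then 1 else 0) \<cdot>\<^sub>m 1\<^sub>m (2 ^ n)"
proof (cases "p = q")
  case True
  then show ?thesis unfolding annihilation_monomial creation_monomial using assms
    by (intro eq_matI) (auto simp: monomial_mat_mult unset_bit_less_power set_bit_less_power bit_unset_bit_iff
      bit_set_bit_iff unset_set_bit set_unset_bit jw_sign_unset_bit jw_sign_set_bit jw_sign_mult_self)
next
  case False
  then consider "p < q" | "q < p" by linarith
  then show ?thesis unfolding annihilation_monomial creation_monomial using False assms
    by cases (intro eq_matI; auto simp: monomial_mat_mult unset_bit_less_power set_bit_less_power bit_unset_bit_iff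
      bit_set_bit_iff jw_sign_unset_bit jw_sign_set_bit unset_set_bit_commute mult.commute)+
qed

section \<open>Particle-number sectors\<close>

lemma sector_projector_carrier [simp]: "sector_projector n N \<in> carrier_mat (2 ^ n) (2 ^ n)"
  by (simp add: sector_projector_def)

lemma sector_projector_hermitian: "mat_adjoint (sector_projector n N) = sector_projector n N"
  by (rule eq_matI) (auto simp: sector_projector_def mat_diag_def)

lemma sector_projector_idempotent: "sector_projector n N * sector_projector n N = sector_projector n N"
  unfolding sector_projector_def mat_diag_diag by (rule arg_cong[where f = "mat_diag _"]) auto

text \<open>A hop removes one particle and adds one. The product has to be treated as a unit, since
  each factor alone changes the sector.\<close>

lemma sector_projector_commute_hop:
  assumes "p < n" "q < n"
  shows "sector_projector n N * (creation n p * annihilation n q)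
    = creation n p * annihilation n q * sector_projector n N"
proof -
  \<comment> \<open>The two conditions describe the domain of the composed map: \<open>q\<close> is
    occupied, and after its removal \<open>p\<close> is empty.\<close>
  have "card {r. r < n \<and> bit (set_bit p (unset_bit q j)) r} = card {r. r < n \<and> bit j r}"
    if "bit j q" "\<not> bit (unset_bit q j) p" for j :: nat
    using that assms card_bits_unset_bit[of n j q] by (simp add: card_bits_set_bit)
  then show ?thesis
    unfolding sector_projector_def creation_monomial annihilation_monomial
    by (subst (1 2) monomial_mat_mult) (auto simp: unset_bit_less_power intro!: monomial_mat_commute_diag)
qed

section \<open>The squaring circuit\<close>

lemma one_tensor_mat [simp]: "1\<^sub>m 1 \<otimes>\<^sub>m A = A" for A :: "complex mat"
  by (rule eq_matI) auto

lemma unitary_mat_tensor: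
  assumes "unitary_mat d A" "unitary_mat e B"
  shows "unitary_mat (d * e) (A \<otimes>\<^sub>m B)"
proof -
  note A = unitary_matD[OF assms(1)] and B = unitary_matD[OF assms(2)]
  have "mat_adjoint (A \<otimes>\<^sub>m B) * (A \<otimes>\<^sub>m B) = (mat_adjoint A * A) \<otimes>\<^sub>m (mat_adjoint B * B)"
    unfolding mat_adjoint_tensor by (rule tensor_mat_mult) simp_all
  moreover have "(A \<otimes>\<^sub>m B) * mat_adjoint (A \<otimes>\<^sub>m B) = (A * mat_adjoint A) \<otimes>\<^sub>m (B * mat_adjoint B)"
    unfolding mat_adjoint_tensor by (rule tensor_mat_mult) simp_all
  ultimately show ?thesis
    unfolding unitary_mat_def using tensor_mat_carrier[OF A(1) B(1)] A(2,3) B(2,3) by (simp add: tensor_mat_one)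
qed

lemma sandwich_one_minus:
  fixes X Y Z :: "complex mat"
  assumes X: "X \<in> carrier_mat p d" and Y: "Y \<in> carrier_mat d d" and Z: "Z \<in> carrier_mat d q"
  shows "X * (1\<^sub>m d - k \<cdot>\<^sub>m Y) * Z = X * Z - k \<cdot>\<^sub>m (X * Y * Z)"
proof -
  have kY: "k \<cdot>\<^sub>m Y \<in> carrier_mat d d" using Y by simp
  have XY: "X * Y \<in> carrier_mat p d" by (rule mult_carrier_mat[OF X Y])
  have "X * (1\<^sub>m d - k \<cdot>\<^sub>m Y) = X - k \<cdot>\<^sub>m (X * Y)"
    by (simp only: mult_minus_distrib_mat[OF X one_carrier_mat kY] right_mult_one_mat[OF X] mult_smult_distrib[OF X Y])
  then show ?thesis
    using XY by (simp only: minus_mult_distrib_mat[OF X smult_carrier_mat[OF XY] Z] mult_smult_assoc_mat[OF XY Z])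
qed

section \<open>A reflection with a prescribed block\<close>

definition plus_projector :: "complex mat" where
  "plus_projector = mat 2 2 (\<lambda>_. 1 / 2)"

lemma plus_projector_carrier [simp]: "plus_projector \<in> carrier_mat 2 2"
  by (simp add: plus_projector_def)

lemma dim_plus_projector [simp]: "dim_row plus_projector = 2" "dim_col plus_projector = 2"
  by (simp_all add: plus_projector_def)

lemma mat_adjoint_plus_projector: "mat_adjoint plus_projector = plus_projector"
  by (rule eq_matI) (auto simp: plus_projector_def)

lemma plus_projector_idempotent: "plus_projector * plus_projector = plus_projector"
  by (rule eq_matI) (auto simp: plus_projector_def scalar_prod_def)

text \<open>This is \<open>1 \<otimes> X + \<sigma> \<otimes> (1 - X)\<close>, where \<open>\<sigma> = 1 - 2 |+\<rangle>\<langle>+|\<close> has zero diagonal; hence compressing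
  the left qubit to \<open>|0\<rangle>\<close> leaves \<open>X\<close>.\<close>
definition flag_reflection :: "nat \<Rightarrow> complex mat \<Rightarrow> complex mat" where
  "flag_reflection d X = 1\<^sub>m (2 * d) - 2 \<cdot>\<^sub>m (plus_projector \<otimes>\<^sub>m (1\<^sub>m d - X))"

text \<open>The complement of a projector is a projector, and so is a Kronecker product of two
  projectors.\<close>

lemma flag_reflection_unitary:
  assumes X: "hermitian_mat d X" and XX: "X * X = X"
  shows "unitary_mat (2 * d) (flag_reflection d X)"
  unfolding flag_reflection_def
proof (rule hermitian_idempotent_reflection)
  have c: "X \<in> carrier_mat d d" and h: "mat_adjoint X = X" using X by (auto simp: hermitian_mat_def)
  have c1: "1\<^sub>m d - X \<in> carrier_mat d d" using c by (rule minus_carrier_mat)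
  have "mat_adjoint (1\<^sub>m d - X) = 1\<^sub>m d - X"
    using mat_adjoint_minus[OF one_carrier_mat c] h by simp
  then show "hermitian_mat (2 * d) (plus_projector \<otimes>\<^sub>m (1\<^sub>m d - X))"
    using tensor_mat_carrier[OF plus_projector_carrier c1]
    by (simp add: hermitian_mat_def mat_adjoint_tensor mat_adjoint_plus_projector)
  have "(1\<^sub>m d - X) * (1\<^sub>m d - X) = (1\<^sub>m d - X) - (X - X * X)"
    by (simp only: minus_mult_distrib_mat[OF one_carrier_mat c c1] mult_minus_distrib_mat[OF c one_carrier_mat c]
      left_mult_one_mat[OF c1] right_mult_one_mat[OF c])
  also have "\<dots> = 1\<^sub>m d - X" unfolding XX using c by (intro eq_matI) auto
  finally have "(1\<^sub>m d - X) * (1\<^sub>m d - X) = 1\<^sub>m d - X" .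
  then show "(plus_projector \<otimes>\<^sub>m (1\<^sub>m d - X)) * (plus_projector \<otimes>\<^sub>m (1\<^sub>m d - X)) = plus_projector \<otimes>\<^sub>m (1\<^sub>m d - X)"
    using c by (subst tensor_mat_mult) (auto simp: plus_projector_idempotent)
qed

text \<open>The diagonal entry 1/2 of \<open>plus_projector\<close> cancels the factor 2 of the
  reflection, and the two copies of \<open>mat_adjoint B * B\<close> cancel, so \<open>B\<close>
  need not be an isometry. The circuit uses \<open>B = U * K\<close> with \<open>K\<close> the
  embedding at all-zero ancillas; the flag-qubit unitaries use the identity.\<close>

lemma flag_reflection_compress:
  assumes X: "X \<in> carrier_mat d d" and B: "B \<in> carrier_mat d r"
  shows "mat_adjoint (ket 1 0 \<otimes>\<^sub>m B) * flag_reflection d X * (ket 1 0 \<otimes>\<^sub>m B) = mat_adjoint B * X * B"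
proof -
  let ?e = "ket 1 0" and ?Y = "1\<^sub>m d - X"
  have e: "?e \<in> carrier_mat 2 1" using ket_carrier[of 1 0] by simp
  have B': "mat_adjoint B \<in> carrier_mat r d" using B by simp
  have Y: "?Y \<in> carrier_mat d d" using X by (rule minus_carrier_mat)
  have eB: "?e \<otimes>\<^sub>m B \<in> carrier_mat (2 * d) r" using tensor_mat_carrier[OF e B] by simp
  have eB': "mat_adjoint (?e \<otimes>\<^sub>m B) \<in> carrier_mat r (2 * d)" using eB by simp
  have JY: "plus_projector \<otimes>\<^sub>m ?Y \<in> carrier_mat (2 * d) (2 * d)"
    by (rule tensor_mat_carrier[OF plus_projector_carrier Y])
  have ee: "mat_adjoint ?e * ?e = 1\<^sub>m 1" using ket_inner[of 0 1 0] by simp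
  have eJe: "mat_adjoint ?e * plus_projector * ?e = (1 / 2) \<cdot>\<^sub>m 1\<^sub>m 1"
    by (rule eq_matI) (auto simp: scalar_prod_def plus_projector_def numeral_2_eq_2)
  have 1: "mat_adjoint (?e \<otimes>\<^sub>m B) * (?e \<otimes>\<^sub>m B) = mat_adjoint B * B"
    unfolding mat_adjoint_tensor by (subst tensor_mat_mult) (simp_all only: ee one_tensor_mat dim_mat_adjoint)
  have "mat_adjoint (?e \<otimes>\<^sub>m B) * (plus_projector \<otimes>\<^sub>m ?Y)
      = (mat_adjoint ?e * plus_projector) \<otimes>\<^sub>m (mat_adjoint B * ?Y)"
    unfolding mat_adjoint_tensor by (rule tensor_mat_mult) (use B X in auto)
  moreover have "((mat_adjoint ?e * plus_projector) \<otimes>\<^sub>m (mat_adjoint B * ?Y)) * (?e \<otimes>\<^sub>m B)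
      = (mat_adjoint ?e * plus_projector * ?e) \<otimes>\<^sub>m (mat_adjoint B * ?Y * B)"
    by (rule tensor_mat_mult) (use B X in auto)
  ultimately have 2: "mat_adjoint (?e \<otimes>\<^sub>m B) * (plus_projector \<otimes>\<^sub>m ?Y) * (?e \<otimes>\<^sub>m B)
      = (1 / 2) \<cdot>\<^sub>m (mat_adjoint B * ?Y * B)"
    by (simp only: eJe tensor_mat_smult_left one_tensor_mat)
  have BX: "mat_adjoint B * X \<in> carrier_mat r d" by (rule mult_carrier_mat[OF B' X])
  have 3: "mat_adjoint B * ?Y * B = mat_adjoint B * B - mat_adjoint B * X * B"
    by (simp only: mult_minus_distrib_mat[OF B' one_carrier_mat X] right_mult_one_mat[OF B']
      minus_mult_distrib_mat[OF B' BX B])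
  have c: "mat_adjoint B * B \<in> carrier_mat r r" "mat_adjoint B * X * B \<in> carrier_mat r r"
    by (rule mult_carrier_mat[OF B' B], rule mult_carrier_mat[OF BX B])
  show ?thesis
    unfolding flag_reflection_def sandwich_one_minus[OF eB' JY eB] 1 2 3
    using c by (intro eq_matI) (auto simp: diff_divide_distrib)
qed

definition square_circuit :: "nat \<Rightarrow> qsvt2" where
  "square_circuit t = QSVT2 False True (1\<^sub>m (2 ^ (t + 1)))
     (flag_reflection (2 ^ t) (ket t 0 * mat_adjoint (ket t 0))) (1\<^sub>m (2 ^ (t + 1)))"

lemma ket_projector:
  assumes "k < 2 ^ t"
  shows "hermitian_mat (2 ^ t) (ket t k * mat_adjoint (ket t k))"
    "ket t k * mat_adjoint (ket t k) * (ket t k * mat_adjoint (ket t k)) = ket t k * mat_adjoint (ket t k)"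
proof -
  let ?k = "ket t k"
  have k: "?k \<in> carrier_mat (2 ^ t) 1" and k': "mat_adjoint ?k \<in> carrier_mat 1 (2 ^ t)"
    by (simp_all only: mat_adjoint_carrier ket_carrier)
  have kk: "?k * mat_adjoint ?k \<in> carrier_mat (2 ^ t) (2 ^ t)" by (rule mult_carrier_mat[OF k k'])
  show "hermitian_mat (2 ^ t) (?k * mat_adjoint ?k)"
    using kk by (simp add: hermitian_mat_def mat_adjoint_mult)
  have "mat_adjoint ?k * (?k * mat_adjoint ?k) = mat_adjoint ?k"
    by (rule adjoint_mult_cancel[OF _ k k']) (use assms in \<open>simp add: ket_inner\<close>)
  then show "?k * mat_adjoint ?k * (?k * mat_adjoint ?k) = ?k * mat_adjoint ?k"
    by (simp only: assoc_mult_mat[OF k k' kk])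
qed

lemma square_circuit_wf: "qsvt2_wf t (square_circuit t)"
  unfolding qsvt2_wf_def square_circuit_def
  using flag_reflection_unitary[OF ket_projector[of 0 t]] by (simp add: unitary_mat_one)

text \<open>Extended by the identity on the system, the gate is again a flag reflection, over the
  projector on all-zero ancillas; this lets the compression identity be applied to it.\<close>

lemma flag_reflection_tensor_one:
  assumes X: "X \<in> carrier_mat d d"
  shows "flag_reflection d X \<otimes>\<^sub>m 1\<^sub>m r = flag_reflection (d * r) (X \<otimes>\<^sub>m 1\<^sub>m r)"
proof -
  have c: "1\<^sub>m d - X \<in> carrier_mat d d" using X by (rule minus_carrier_mat)
  have "2 \<cdot>\<^sub>m (plus_projector \<otimes>\<^sub>m (1\<^sub>m d - X)) \<in> carrier_mat (2 * d) (2 * d)"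
    using tensor_mat_carrier[OF plus_projector_carrier c] by simp
  then show ?thesis unfolding flag_reflection_def
    by (simp only: tensor_mat_minus_left[OF one_carrier_mat] tensor_mat_one tensor_mat_smult_left tensor_mat_assoc
      tensor_mat_minus_left[OF one_carrier_mat X] mult.assoc)
qed

text \<open>The projector \<open>?X\<close> between the two uses of \<open>U\<close> factors through
  the system, which splits the compressed circuit into two blocks of \<open>U\<close>, the left one
  adjoint.\<close>

lemma encoded_block_square_circuit:
  assumes U: "unitary_mat (2 ^ t * 2 ^ n) U"
  shows "encoded_block n (t + 1) (qsvt2_apply n (square_circuit t) U)
    = mat_adjoint (encoded_block n t U) * encoded_block n t U"
proof -
  let ?D = "2 ^ t * 2 ^ n :: nat" and ?K = "ket t 0 \<otimes>\<^sub>m 1\<^sub>m (2 ^ n)" and ?e = "ket 1 0"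
  let ?B = "U * ?K" and ?X = "?K * mat_adjoint ?K"
  have cU: "U \<in> carrier_mat ?D ?D" using unitary_matD[OF U] by simp
  have cU': "mat_adjoint U \<in> carrier_mat ?D ?D" using cU by simp
  have K: "?K \<in> carrier_mat ?D (2 ^ n)"
    using tensor_mat_carrier[OF ket_carrier[of t 0] one_carrier_mat[of "2 ^ n"]] by simp
  have K': "mat_adjoint ?K \<in> carrier_mat (2 ^ n) ?D" using K by simp
  have B: "?B \<in> carrier_mat ?D (2 ^ n)" by (rule mult_carrier_mat[OF cU K])
  have B': "mat_adjoint ?B \<in> carrier_mat (2 ^ n) ?D" using B by simp
  have X: "?X \<in> carrier_mat ?D ?D" by (rule mult_carrier_mat[OF K K'])
  have e: "?e \<in> carrier_mat 2 1" using ket_carrier[of 1 0] by simp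
  have one: "1\<^sub>m (2 ^ (t + 1)) \<otimes>\<^sub>m 1\<^sub>m (2 ^ n) = (1\<^sub>m (2 * ?D) :: complex mat)"
    by (simp add: tensor_mat_one mult.assoc)
  have "(ket t 0 * mat_adjoint (ket t 0)) \<otimes>\<^sub>m 1\<^sub>m (2 ^ n) = ?X"
    unfolding mat_adjoint_tensor by (subst tensor_mat_mult) simp_all
  then have gate: "flag_reflection (2 ^ t) (ket t 0 * mat_adjoint (ket t 0)) \<otimes>\<^sub>m 1\<^sub>m (2 ^ n) = flag_reflection ?D ?X"
    using flag_reflection_tensor_one[OF mult_carrier_mat[OF ket_carrier mat_adjoint_carrier[THEN iffD2, OF ket_carrier]], of t 0 0 "2 ^ n"]
    by simp
  let ?G = "flag_reflection ?D ?X"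
  have G: "?G \<in> carrier_mat (2 * ?D) (2 * ?D)"
    unfolding flag_reflection_def
    using tensor_mat_carrier[OF plus_projector_carrier minus_carrier_mat[OF X]] by (intro minus_carrier_mat) simp
  let ?U1 = "1\<^sub>m 2 \<otimes>\<^sub>m U" and ?Kt = "?e \<otimes>\<^sub>m ?K"
  have U1: "?U1 \<in> carrier_mat (2 * ?D) (2 * ?D)" by (rule tensor_mat_carrier[OF one_carrier_mat cU])
  have U1': "mat_adjoint ?U1 \<in> carrier_mat (2 * ?D) (2 * ?D)" using U1 by simp
  have Kt: "?Kt \<in> carrier_mat (2 * ?D) (2 ^ n)" using tensor_mat_carrier[OF e K] by simp
  have Kt': "mat_adjoint ?Kt \<in> carrier_mat (2 ^ n) (2 * ?D)" using Kt by simp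
  have UG: "mat_adjoint ?U1 * ?G \<in> carrier_mat (2 * ?D) (2 * ?D)" by (rule mult_carrier_mat[OF U1' G])
  have UGU: "mat_adjoint ?U1 * ?G * ?U1 \<in> carrier_mat (2 * ?D) (2 * ?D)" by (rule mult_carrier_mat[OF UG U1])
  have adj: "mat_adjoint ?U1 = 1\<^sub>m 2 \<otimes>\<^sub>m mat_adjoint U" by (simp add: mat_adjoint_tensor)
  have circ: "qsvt2_apply n (square_circuit t) U = mat_adjoint ?U1 * ?G * ?U1"
    unfolding qsvt2_apply_def square_circuit_def qsvt2.sel adj[symmetric] gate one if_True if_False
    by (simp only: left_mult_one_mat[OF U1'] right_mult_one_mat[OF UG] right_mult_one_mat[OF UGU])
  have ket: "ket (t + 1) 0 \<otimes>\<^sub>m 1\<^sub>m (2 ^ n) = ?Kt"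
    using ket_add_zero[of 1 t] by (simp add: tensor_mat_assoc add.commute)
  have UK: "?U1 * ?Kt = ?e \<otimes>\<^sub>m ?B"
    using e K cU by (subst tensor_mat_mult) auto
  have UKc: "?U1 * ?Kt \<in> carrier_mat (2 * ?D) (2 ^ n)" by (rule mult_carrier_mat[OF U1 Kt])
  have "encoded_block n (t + 1) (qsvt2_apply n (square_circuit t) U)
      = mat_adjoint ?Kt * (mat_adjoint ?U1 * ?G * ?U1) * ?Kt"
    unfolding encoded_block_def circ ket ..
  \<comment> \<open>Each use of \<open>U\<close> is absorbed into the embedding next to it, leaving
    only the reflection in the middle.\<close>
  also have "\<dots> = mat_adjoint ?Kt * mat_adjoint ?U1 * ?G * (?U1 * ?Kt)"
    by (simp only: assoc_mult_mat[OF Kt' UGU Kt] assoc_mult_mat[OF UG U1 Kt] assoc_mult_mat[OF U1' G UKc]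
      assoc_mult_mat[OF mult_carrier_mat[OF Kt' U1'] G UKc] assoc_mult_mat[OF Kt' U1' mult_carrier_mat[OF G UKc]])
  also have "mat_adjoint ?Kt * mat_adjoint ?U1 = mat_adjoint (?U1 * ?Kt)"
    using U1 Kt by (subst mat_adjoint_mult) auto
  also have "mat_adjoint (?U1 * ?Kt) * ?G * (?U1 * ?Kt) = mat_adjoint ?B * ?X * ?B"
    unfolding UK by (rule flag_reflection_compress[OF X B])
  also have "\<dots> = (mat_adjoint ?B * ?K) * (mat_adjoint ?K * ?B)"
    by (simp only: assoc_mult_mat[OF B' X B] assoc_mult_mat[OF K K' B] assoc_mult_mat[OF B' K mult_carrier_mat[OF K' B]])
  also have "mat_adjoint ?K * ?B = encoded_block n t U"
    unfolding encoded_block_def by (rule assoc_mult_mat[OF K' cU K, symmetric])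
  \<comment> \<open>Rewriting the left factor as an adjoint exposes a second copy of the
    block.\<close>
  also have "mat_adjoint ?B * ?K = mat_adjoint (mat_adjoint ?K * ?B)"
    using B K by (subst mat_adjoint_mult) auto
  also have "mat_adjoint ?K * ?B = encoded_block n t U"
    unfolding encoded_block_def by (rule assoc_mult_mat[OF K' cU K, symmetric])
  finally show ?thesis .
qed

lemma qsvt2_apply_unitary:
  assumes C: "qsvt2_wf t C" and U: "unitary_mat (2 ^ t * 2 ^ n) U"
  shows "unitary_mat (2 ^ (t + 1) * 2 ^ n) (qsvt2_apply n C U)"
proof -
  have d: "2 ^ (t + 1) * 2 ^ n = 2 * (2 ^ t * 2 ^ n :: nat)" by simp
  have g: "unitary_mat (2 ^ (t + 1) * 2 ^ n) (g \<otimes>\<^sub>m 1\<^sub>m (2 ^ n))" if "unitary_mat (2 ^ (t + 1)) g" for g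
    using that unitary_mat_one by (rule unitary_mat_tensor)
  have u: "unitary_mat (2 ^ (t + 1) * 2 ^ n) (1\<^sub>m 2 \<otimes>\<^sub>m X)" if "unitary_mat (2 ^ t * 2 ^ n) X" for X
    unfolding d using unitary_mat_one that by (rule unitary_mat_tensor)
  show ?thesis
    using C unfolding qsvt2_apply_def qsvt2_wf_def
    by (intro unitary_mat_mult g u) (auto simp: U unitary_mat_adjoint)
qed

text \<open>A Hermitian block equals its adjoint, so the adjoint in the general formula
  disappears.\<close>

lemma square_circuit_implements_square: "qsvt2_implements_square n t (square_circuit t)"
  unfolding qsvt2_implements_square_def hermitian_mat_def
  by (intro allI impI, elim conjE) (simp only: encoded_block_square_circuit)

section \<open>PREP and SELECT\<close>

text \<open>Orthogonality removes the cross terms of the double sum. The same fact gives the norm of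
  the PREP state, the block of the composed circuit and the unitarity of a block-diagonal
  matrix.\<close>

lemma sum_mat_adjoint_mult_orthogonal:
  assumes I: "finite I"
    and G: "\<And>x. x \<in> I \<Longrightarrow> G x \<in> carrier_mat m r" and H: "\<And>x. x \<in> I \<Longrightarrow> H x \<in> carrier_mat m r'"
    and orth: "\<And>x y. x \<in> I \<Longrightarrow> y \<in> I \<Longrightarrow> x \<noteq> y \<Longrightarrow> mat_adjoint (G x) * H y = 0\<^sub>m r r'"
  shows "mat_adjoint (sum_mat m r (\<lambda>x. u x \<cdot>\<^sub>m G x) I) * sum_mat m r' (\<lambda>x. v x \<cdot>\<^sub>m H x) I
    = sum_mat r r' (\<lambda>x. (cnj (u x) * v x) \<cdot>\<^sub>m (mat_adjoint (G x) * H x)) I" (is "_ * ?H = _")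
proof -
  have G': "mat_adjoint (G x) \<in> carrier_mat r m" if "x \<in> I" for x using G[OF that] by simp
  have prod: "(cnj (u x) \<cdot>\<^sub>m mat_adjoint (G x)) * (v y \<cdot>\<^sub>m H y) = (cnj (u x) * v y) \<cdot>\<^sub>m (mat_adjoint (G x) * H y)"
    if "x \<in> I" "y \<in> I" for x y
    by (simp only: mult_smult_assoc_mat[OF G'[OF that(1)] smult_carrier_mat[OF H[OF that(2)]]]
      mult_smult_distrib[OF G'[OF that(1)] H[OF that(2)]] smult_smult_mat)
  have "mat_adjoint (sum_mat m r (\<lambda>x. u x \<cdot>\<^sub>m G x) I) = sum_mat r m (\<lambda>x. cnj (u x) \<cdot>\<^sub>m mat_adjoint (G x)) I"
    using G by (subst mat_adjoint_sum_mat) simp_all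
  also have "\<dots> * ?H = sum_mat r r' (\<lambda>x. (cnj (u x) \<cdot>\<^sub>m mat_adjoint (G x)) * ?H) I"
    by (rule sum_mat_mult) (use G' in simp_all)
  also have "\<dots> = sum_mat r r' (\<lambda>x. (cnj (u x) * v x) \<cdot>\<^sub>m (mat_adjoint (G x) * H x)) I"
  proof (rule sum_mat_cong)
    fix x assume x: "x \<in> I"
    have "(cnj (u x) \<cdot>\<^sub>m mat_adjoint (G x)) * ?H
        = sum_mat r r' (\<lambda>y. (cnj (u x) \<cdot>\<^sub>m mat_adjoint (G x)) * (v y \<cdot>\<^sub>m H y)) I"
      by (rule mult_sum_mat) (use G' H x in simp_all)
    also have "\<dots> = sum_mat r r' (\<lambda>y. (cnj (u x) * v y) \<cdot>\<^sub>m (mat_adjoint (G x) * H y)) I"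
      by (rule sum_mat_cong) (rule prod[OF x])
    also have "\<dots> = (cnj (u x) * v x) \<cdot>\<^sub>m (mat_adjoint (G x) * H x)"
      by (rule sum_mat_eq_single[OF I x])
        (use orth[OF x] mult_carrier_mat[OF G'[OF x] H[OF x]] in auto)
    finally show "(cnj (u x) \<cdot>\<^sub>m mat_adjoint (G x)) * ?H = (cnj (u x) * v x) \<cdot>\<^sub>m (mat_adjoint (G x) * H x)" .
  qed
  finally show ?thesis .
qed

lemma branch_sign_mult_abs: "branch_sign x * complex_of_real \<bar>x\<bar> = complex_of_real x"
  by (simp add: branch_sign_def)

lemma cnj_branch_sign [simp]: "cnj (branch_sign x) = branch_sign x"
  by (simp add: branch_sign_def)

lemma branch_sign_square: "branch_sign x * branch_sign x = 1"
  by (simp add: branch_sign_def)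

lemma prep_amplitude_square:
  assumes "g > 0"
  shows "cnj (complex_of_real (1 / sqrt g) * complex_of_real (sqrt \<bar>l\<bar>))
      * (complex_of_real (1 / sqrt g) * complex_of_real (sqrt \<bar>l\<bar>)) = complex_of_real (\<bar>l\<bar> / g)"
proof -
  have "(1 / sqrt g * sqrt \<bar>l\<bar>)\<^sup>2 = \<bar>l\<bar> / g"
    using assms by (simp add: power_mult_distrib power_divide)
  then show ?thesis
    unfolding of_real_mult[symmetric] complex_cnj_complex_of_real by (simp only: power2_eq_square)
qed

lemma zero_tensor_mat: "0\<^sub>m a b \<otimes>\<^sub>m X = 0\<^sub>m (a * dim_row X) (b * dim_col X)" for X :: "complex mat"
  by (rule eq_matI) (auto simp: div_less_times)

text \<open>A linear combination of unitaries: PREP contributes its amplitude on both sides, SELECT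
  the sign, and distinct labels stay orthogonal. No sector projector occurs, so the formula gives
  both the compressed block and its leakage.\<close>

lemma encoded_block_prep_select:
  assumes prep: "is_prep a c R lam PREP" and sel: "is_select n a c R lam W SELECT"
    and inj: "inj_on c {..<R}" and c: "\<And>\<xi>. \<xi> < R \<Longrightarrow> c \<xi> < 2 ^ a"
    and W: "\<And>\<xi>. \<xi> < R \<Longrightarrow> W \<xi> \<in> carrier_mat (2 * 2 ^ n) (2 * 2 ^ n)"
    and pos: "weight_norm R lam > 0"
  shows "encoded_block n (a + 1) (prep_select_prep n PREP SELECT)
    = sum_mat (2 ^ n) (2 ^ n) (\<lambda>\<xi>. complex_of_real (lam \<xi> / weight_norm R lam) \<cdot>\<^sub>m encoded_block n 1 (W \<xi>)) {..<R}"
proof -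
  define N where "N = (2 ^ n :: nat)"
  define M where "M = (2 ^ a * (2 * N) :: nat)"
  define Kn where "Kn = ket 1 0 \<otimes>\<^sub>m 1\<^sub>m N"
  define q where "q \<xi> = complex_of_real (1 / sqrt (weight_norm R lam)) * complex_of_real (sqrt \<bar>lam \<xi>\<bar>)" for \<xi>
  define G where "G \<xi> = ket a (c \<xi>) \<otimes>\<^sub>m Kn" for \<xi>
  define H where "H \<xi> = ket a (c \<xi>) \<otimes>\<^sub>m (branch_sign (lam \<xi>) \<cdot>\<^sub>m (W \<xi> * Kn))" for \<xi>
  define F where "F = sum_mat M N (\<lambda>\<xi>. q \<xi> \<cdot>\<^sub>m G \<xi>) {..<R}"
  define Pr where "Pr = PREP \<otimes>\<^sub>m 1\<^sub>m (2 * N)"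
  define K where "K = ket a 0 \<otimes>\<^sub>m Kn"
  have Kn: "Kn \<in> carrier_mat (2 * N) N"
    using tensor_mat_carrier[OF ket_carrier[of 1 0] one_carrier_mat[of N]] by (simp add: Kn_def)
  have PREP: "PREP \<in> carrier_mat (2 ^ a) (2 ^ a)" using prep by (simp add: is_prep_def unitary_mat_def)
  have SEL: "SELECT \<in> carrier_mat M M" using sel by (simp add: is_select_def unitary_mat_def M_def N_def)
  have WK: "W \<xi> * Kn \<in> carrier_mat (2 * N) N" if "\<xi> < R" for \<xi>
    using mult_carrier_mat[OF W[OF that] Kn[unfolded N_def]] by (simp add: N_def)
  have tk: "ket a k \<otimes>\<^sub>m X \<in> carrier_mat M N" if "X \<in> carrier_mat (2 * N) N" for k X
    using tensor_mat_carrier[OF ket_carrier that] by (simp add: M_def)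
  have G: "G \<xi> \<in> carrier_mat M N" for \<xi> unfolding G_def by (rule tk[OF Kn])
  have H: "H \<xi> \<in> carrier_mat M N" if "\<xi> < R" for \<xi>
    unfolding H_def by (rule tk[OF smult_carrier_mat[OF WK[OF that]]])
  have K: "K \<in> carrier_mat M N" unfolding K_def by (rule tk[OF Kn])
  have Pr: "Pr \<in> carrier_mat M M"
    unfolding Pr_def M_def by (rule tensor_mat_carrier[OF PREP one_carrier_mat])
  have F: "F \<in> carrier_mat M N" by (simp add: F_def)
  \<comment> \<open>\<open>F\<close> is the embedding of the system along the prepared index state
    with the flag at zero; the block is SELECT compressed by \<open>F\<close>.\<close>
  have "Pr * K = (PREP * ket a 0) \<otimes>\<^sub>m (1\<^sub>m (2 * N) * Kn)"
    unfolding Pr_def K_def by (rule tensor_mat_mult) (use PREP Kn in auto)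
  also have "1\<^sub>m (2 * N) * Kn = Kn" by (rule left_mult_one_mat[OF Kn])
  also have "PREP * ket a 0 = sum_mat (2 ^ a) 1 (\<lambda>\<xi>. q \<xi> \<cdot>\<^sub>m ket a (c \<xi>)) {..<R}"
    using prep unfolding is_prep_def q_def
    by (simp only: smult_sum_mat[OF smult_carrier_mat[OF ket_carrier]] smult_smult_mat)
  also have "\<dots> \<otimes>\<^sub>m Kn = sum_mat (2 ^ a * (2 * N)) (1 * N) (\<lambda>\<xi>. (q \<xi> \<cdot>\<^sub>m ket a (c \<xi>)) \<otimes>\<^sub>m Kn) {..<R}"
    by (rule tensor_sum_mat[OF smult_carrier_mat[OF ket_carrier] Kn])
  also have "\<dots> = F" by (simp add: F_def G_def M_def tensor_mat_smult_left)
  finally have PK: "Pr * K = F" .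
  have sG: "SELECT * G \<xi> = H \<xi>" if \<xi>: "\<xi> < R" for \<xi>
  proof -
    have kc: "ket a (c \<xi>) \<otimes>\<^sub>m 1\<^sub>m (2 * N) \<in> carrier_mat M (2 * N)"
      using tensor_mat_carrier[OF ket_carrier one_carrier_mat, of a "c \<xi>" "2 * N"] by (simp add: M_def)
    \<comment> \<open>SELECT is specified on an index ket with flag and system left open; identities
      of size 1 let \<open>Kn\<close> be split off to reach that form.\<close>
    have "G \<xi> = (ket a (c \<xi>) * 1\<^sub>m 1) \<otimes>\<^sub>m (1\<^sub>m (2 * N) * Kn)"
      unfolding G_def by (simp only: right_mult_one_mat[OF ket_carrier] left_mult_one_mat[OF Kn])
    also have "\<dots> = (ket a (c \<xi>) \<otimes>\<^sub>m 1\<^sub>m (2 * N)) * (1\<^sub>m 1 \<otimes>\<^sub>m Kn)"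
      by (rule tensor_mat_mult[symmetric]) (use Kn in auto)
    finally have "SELECT * G \<xi> = SELECT * (ket a (c \<xi>) \<otimes>\<^sub>m 1\<^sub>m (2 * N)) * Kn"
      by (simp only: one_tensor_mat assoc_mult_mat[OF SEL kc Kn])
    also have "SELECT * (ket a (c \<xi>) \<otimes>\<^sub>m 1\<^sub>m (2 * N)) = ket a (c \<xi>) \<otimes>\<^sub>m (branch_sign (lam \<xi>) \<cdot>\<^sub>m W \<xi>)"
      using sel \<xi> by (simp add: is_select_def N_def)
    also have "\<dots> * Kn = (ket a (c \<xi>) \<otimes>\<^sub>m (branch_sign (lam \<xi>) \<cdot>\<^sub>m W \<xi>)) * (1\<^sub>m 1 \<otimes>\<^sub>m Kn)"
      by (simp only: one_tensor_mat)
    also have "\<dots> = (ket a (c \<xi>) * 1\<^sub>m 1) \<otimes>\<^sub>m ((branch_sign (lam \<xi>) \<cdot>\<^sub>m W \<xi>) * Kn)"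
      by (rule tensor_mat_mult) (use Kn W[OF \<xi>] in \<open>auto simp: N_def\<close>)
    also have "\<dots> = H \<xi>"
      unfolding H_def
      by (simp only: right_mult_one_mat[OF ket_carrier] mult_smult_assoc_mat[OF W[OF \<xi>] Kn[unfolded N_def]])
    finally show ?thesis .
  qed
  have SF: "SELECT * F = sum_mat M N (\<lambda>\<xi>. q \<xi> \<cdot>\<^sub>m H \<xi>) {..<R}"
  proof -
    have "SELECT * F = sum_mat M N (\<lambda>\<xi>. SELECT * (q \<xi> \<cdot>\<^sub>m G \<xi>)) {..<R}"
      unfolding F_def by (rule mult_sum_mat[OF SEL smult_carrier_mat[OF G]])
    also have "\<dots> = sum_mat M N (\<lambda>\<xi>. q \<xi> \<cdot>\<^sub>m H \<xi>) {..<R}"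
      by (rule sum_mat_cong) (simp add: mult_smult_distrib[OF SEL G] sG)
    finally show ?thesis .
  qed
  have GH: "mat_adjoint (G x) * H y = (mat_adjoint (ket a (c x)) * ket a (c y))
      \<otimes>\<^sub>m (branch_sign (lam y) \<cdot>\<^sub>m (mat_adjoint Kn * (W y * Kn)))" if "y < R" for x y
  proof -
    have "mat_adjoint (G x) * H y = (mat_adjoint (ket a (c x)) * ket a (c y))
      \<otimes>\<^sub>m (mat_adjoint Kn * (branch_sign (lam y) \<cdot>\<^sub>m (W y * Kn)))"
      unfolding G_def H_def mat_adjoint_tensor by (rule tensor_mat_mult) (use Kn WK[OF that] W[OF that] in \<open>auto simp: N_def\<close>)
    then show ?thesis
      by (simp only: mult_smult_distrib[OF mat_adjoint_carrier[THEN iffD2, OF Kn] WK[OF that]])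
  qed
  have "prep_select_prep n PREP SELECT = mat_adjoint Pr * SELECT * Pr"
    unfolding prep_select_prep_def Pr_def by (simp add: mat_adjoint_tensor N_def)
  moreover have "ket (a + 1) 0 \<otimes>\<^sub>m 1\<^sub>m (2 ^ n) = K"
    unfolding ket_add_zero tensor_mat_assoc K_def Kn_def N_def ..
  ultimately have "encoded_block n (a + 1) (prep_select_prep n PREP SELECT)
      = mat_adjoint K * (mat_adjoint Pr * SELECT * Pr) * K"
    unfolding encoded_block_def by simp
  also have "\<dots> = (mat_adjoint K * mat_adjoint Pr) * (SELECT * (Pr * K))"
  proof -
    have K': "mat_adjoint K \<in> carrier_mat N M" and Pr': "mat_adjoint Pr \<in> carrier_mat M M"
      using K Pr by simp_all
    note PS = mult_carrier_mat[OF Pr' SEL] and PK = mult_carrier_mat[OF Pr K]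
    note PSP = mult_carrier_mat[OF PS Pr] and SPK = mult_carrier_mat[OF SEL PK]
    show ?thesis
      by (simp only: assoc_mult_mat[OF K' PSP K] assoc_mult_mat[OF PS Pr K] assoc_mult_mat[OF Pr' SEL PK]
        assoc_mult_mat[OF K' Pr' SPK])
  qed
  also have "mat_adjoint K * mat_adjoint Pr = mat_adjoint F"
    unfolding PK[symmetric] using Pr K by (subst mat_adjoint_mult) auto
  also have "SELECT * (Pr * K) = sum_mat M N (\<lambda>\<xi>. q \<xi> \<cdot>\<^sub>m H \<xi>) {..<R}"
    unfolding PK by (rule SF)
  also have "mat_adjoint F * \<dots> = sum_mat N N (\<lambda>\<xi>. (cnj (q \<xi>) * q \<xi>) \<cdot>\<^sub>m (mat_adjoint (G \<xi>) * H \<xi>)) {..<R}"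
    unfolding F_def
  proof (rule sum_mat_adjoint_mult_orthogonal)
    fix x y assume xy: "x \<in> {..<R}" "y \<in> {..<R}" "x \<noteq> y"
    then have "c x \<noteq> c y" using inj by (auto dest: inj_onD)
    then show "mat_adjoint (G x) * H y = 0\<^sub>m N N"
      using xy Kn GH[of y x] c[of x] c[of y] by (simp add: ket_inner zero_tensor_mat)
  qed (use G H in auto)
  also have "\<dots> = sum_mat N N (\<lambda>\<xi>. complex_of_real (lam \<xi> / weight_norm R lam) \<cdot>\<^sub>m encoded_block n 1 (W \<xi>)) {..<R}"
  proof (rule sum_mat_cong)
    fix x assume x: "x \<in> {..<R}"
    have "mat_adjoint (G x) * H x = branch_sign (lam x) \<cdot>\<^sub>m (mat_adjoint Kn * (W x * Kn))"
      using x GH[of x x] c[of x] ket_inner[of "c x" a "c x"] by (simp add: one_tensor_mat[simplified])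
    also have "mat_adjoint Kn * (W x * Kn) = encoded_block n 1 (W x)"
      unfolding encoded_block_def Kn_def[unfolded N_def, symmetric]
      using x assoc_mult_mat[OF mat_adjoint_carrier[THEN iffD2, OF Kn[unfolded N_def]] W Kn[unfolded N_def]] by simp
    finally have *: "mat_adjoint (G x) * H x = branch_sign (lam x) \<cdot>\<^sub>m encoded_block n 1 (W x)" .
    have "cnj (q x) * q x = complex_of_real (\<bar>lam x\<bar> / weight_norm R lam)"
      unfolding q_def by (rule prep_amplitude_square[OF pos])
    \<comment> \<open>The squared amplitude supplies the modulus of the weight and SELECT its
      sign.\<close>
    then have "cnj (q x) * q x * branch_sign (lam x) = complex_of_real (lam x / weight_norm R lam)"
      using branch_sign_mult_abs[of "lam x"] by (simp add: mult_ac)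
    then show "(cnj (q x) * q x) \<cdot>\<^sub>m (mat_adjoint (G x) * H x)
        = complex_of_real (lam x / weight_norm R lam) \<cdot>\<^sub>m encoded_block n 1 (W x)"
      unfolding * smult_smult_mat by simp
  qed
  finally show ?thesis unfolding N_def .
qed

lemma prep_select_prep_unitary:
  assumes "is_prep a c R lam PREP" "is_select n a c R lam W SELECT"
  shows "unitary_mat (2 ^ (a + 1) * 2 ^ n) (prep_select_prep n PREP SELECT)"
proof -
  have d: "2 ^ (a + 1) * 2 ^ n = 2 ^ a * (2 * 2 ^ n :: nat)" by simp
  show ?thesis
    unfolding d prep_select_prep_def using assms unfolding is_prep_def is_select_def
    by (intro unitary_mat_mult unitary_mat_tensor unitary_mat_one unitary_mat_adjoint) auto
qed

section \<open>Existence of SELECT and PREP\<close>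

text \<open>The witness is the sum of the projectors onto index basis states, each tensored with its
  \<open>B k\<close>. Orthogonality and the resolution of the identity make it unitary.\<close>

lemma exists_block_diagonal_unitary:
  assumes B: "\<And>k. k < 2 ^ a \<Longrightarrow> unitary_mat m (B k)"
  shows "\<exists>S. unitary_mat (2 ^ a * m) S \<and> (\<forall>k<2 ^ a. S * (ket a k \<otimes>\<^sub>m 1\<^sub>m m) = ket a k \<otimes>\<^sub>m B k)"
proof -
  let ?A = "2 ^ a :: nat"
  define E where "E k = ket a k * mat_adjoint (ket a k)" for k
  define T where "T k = E k \<otimes>\<^sub>m B k" for k
  \<comment> \<open>The scalar 1 gives the sum the form required by
    \<open>sum_mat_adjoint_mult_orthogonal\<close>.\<close>
  define S where "S = sum_mat (?A * m) (?A * m) (\<lambda>k. 1 \<cdot>\<^sub>m T k) {..<?A}"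
  note Bc = unitary_matD[OF B]
  have E: "E k \<in> carrier_mat ?A ?A" "mat_adjoint (E k) = E k" if "k < ?A" for k
    using ket_projector(1)[OF that] by (auto simp: E_def hermitian_mat_def)
  have EE: "E k * E l = (if k = l then E k else 0\<^sub>m ?A ?A)" if kl: "k < ?A" "l < ?A" for k l
  proof (cases "k = l")
    case True
    then show ?thesis using ket_projector(2)[OF kl(1)] by (simp add: E_def)
  next
    case False
    have k': "mat_adjoint (ket a k) \<in> carrier_mat 1 ?A" for k by (simp only: mat_adjoint_carrier ket_carrier)
    have "E k * E l = ket a k * ((mat_adjoint (ket a k) * ket a l) * mat_adjoint (ket a l))"
      unfolding E_def
      by (simp only: assoc_mult_mat[OF ket_carrier k' mult_carrier_mat[OF ket_carrier k']]
        assoc_mult_mat[OF k' ket_carrier k'])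
    also have "mat_adjoint (ket a k) * ket a l = 0\<^sub>m 1 1"
      using False kl by (simp add: ket_inner)
    finally show ?thesis
      using False by (simp only: left_mult_zero_mat[OF k'] right_mult_zero_mat[OF ket_carrier] if_False)
  qed
  have T: "T k \<in> carrier_mat (?A * m) (?A * m)" if "k < ?A" for k
    unfolding T_def by (rule tensor_mat_carrier[OF E(1)[OF that] Bc(1)[OF that]])
  have adjT: "mat_adjoint (T k) = E k \<otimes>\<^sub>m mat_adjoint (B k)" if "k < ?A" for k
    unfolding T_def mat_adjoint_tensor using E(2)[OF that] by simp
  have resolution: "sum_mat (?A * m) (?A * m) (\<lambda>k. E k \<otimes>\<^sub>m 1\<^sub>m m) {..<?A} = 1\<^sub>m (?A * m)"
  proof -
    have "sum_mat ?A ?A E {..<?A} = 1\<^sub>m ?A"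
    proof (rule eq_matI)
      fix i j assume "i < dim_row (1\<^sub>m ?A :: complex mat)" "j < dim_col (1\<^sub>m ?A :: complex mat)"
      then have ij: "i < ?A" "j < ?A" by auto
      have "(\<Sum>k<?A. E k $$ (i, j)) = E i $$ (i, j)"
        using ij by (intro sum_eq_single) (auto simp: E_def scalar_prod_def)
      then show "sum_mat ?A ?A E {..<?A} $$ (i, j) = 1\<^sub>m ?A $$ (i, j)"
        using ij by (auto simp: E_def scalar_prod_def)
    qed auto
    moreover have "sum_mat (?A * m) (?A * m) (\<lambda>k. E k \<otimes>\<^sub>m 1\<^sub>m m) {..<?A} = sum_mat ?A ?A E {..<?A} \<otimes>\<^sub>m 1\<^sub>m m"
      by (rule tensor_sum_mat[symmetric]) (use E in auto)
    ultimately show ?thesis by (simp add: tensor_mat_one)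
  qed
  have ST: "S * (ket a l \<otimes>\<^sub>m 1\<^sub>m m) = ket a l \<otimes>\<^sub>m B l" if l: "l < ?A" for l
  proof -
    have kc: "ket a l \<otimes>\<^sub>m 1\<^sub>m m \<in> carrier_mat (?A * m) m"
      using tensor_mat_carrier[OF ket_carrier one_carrier_mat, of a l m] by simp
    have Tk: "(1 \<cdot>\<^sub>m T k) * (ket a l \<otimes>\<^sub>m 1\<^sub>m m) = (if k = l then ket a l \<otimes>\<^sub>m B l else 0\<^sub>m (?A * m) m)"
      if k: "k < ?A" for k
    proof -
      have k': "mat_adjoint (ket a k) \<in> carrier_mat 1 ?A" by (simp only: mat_adjoint_carrier ket_carrier)
      have "T k * (ket a l \<otimes>\<^sub>m 1\<^sub>m m) = (E k * ket a l) \<otimes>\<^sub>m (B k * 1\<^sub>m m)"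
        unfolding T_def by (rule tensor_mat_mult) (use E(1)[OF k] Bc(1)[OF k] in auto)
      also have "B k * 1\<^sub>m m = B k" by (rule right_mult_one_mat[OF Bc(1)[OF k]])
      also have "E k * ket a l = ket a k * (mat_adjoint (ket a k) * ket a l)"
        unfolding E_def by (rule assoc_mult_mat[OF ket_carrier k' ket_carrier])
      also have "\<dots> = (if k = l then ket a l else 0\<^sub>m ?A 1)"
        unfolding ket_inner[OF k l]
        by (cases "k = l") (simp_all only: simp_thms if_True if_False right_mult_one_mat[OF ket_carrier] right_mult_zero_mat[OF ket_carrier])
      finally show ?thesis
        unfolding one_smult_mat using Bc(1)[OF k] by (auto simp: zero_tensor_mat)
    qed
    have "S * (ket a l \<otimes>\<^sub>m 1\<^sub>m m) = sum_mat (?A * m) m (\<lambda>k. (1 \<cdot>\<^sub>m T k) * (ket a l \<otimes>\<^sub>m 1\<^sub>m m)) {..<?A}"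
      unfolding S_def by (rule sum_mat_mult[OF kc smult_carrier_mat[OF T]]) simp
    also have "\<dots> = (1 \<cdot>\<^sub>m T l) * (ket a l \<otimes>\<^sub>m 1\<^sub>m m)"
      by (rule sum_mat_eq_single) (use l Tk tensor_mat_carrier[OF ket_carrier Bc(1)[OF l], of a l] in auto)
    finally show ?thesis using Tk[OF l] by simp
  qed
  have S: "S \<in> carrier_mat (?A * m) (?A * m)" by (simp add: S_def)
  \<comment> \<open>The second equation keeps a double adjoint so that the same orthogonality lemma,
    applied to the adjoint family, yields the other half of unitarity.\<close>
  have TT: "mat_adjoint (T k) * T l = (if k = l then E k \<otimes>\<^sub>m 1\<^sub>m m else 0\<^sub>m (?A * m) (?A * m))"
    "mat_adjoint (mat_adjoint (T k)) * mat_adjoint (T l) = (if k = l then E k \<otimes>\<^sub>m 1\<^sub>m m else 0\<^sub>m (?A * m) (?A * m))"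
    if kl: "k < ?A" "l < ?A" for k l
  proof -
    note c = E(1)[OF kl(1)] E(1)[OF kl(2)] Bc(1)[OF kl(1)] Bc(1)[OF kl(2)]
    have "mat_adjoint (T k) * T l = (E k * E l) \<otimes>\<^sub>m (mat_adjoint (B k) * B l)"
      unfolding adjT[OF kl(1)] unfolding T_def by (rule tensor_mat_mult) (use c in auto)
    then show "mat_adjoint (T k) * T l = (if k = l then E k \<otimes>\<^sub>m 1\<^sub>m m else 0\<^sub>m (?A * m) (?A * m))"
      using c EE[OF kl] Bc(2)[OF kl(1)] by (auto simp: zero_tensor_mat)
    have "T k * mat_adjoint (T l) = (E k * E l) \<otimes>\<^sub>m (B k * mat_adjoint (B l))"
      unfolding adjT[OF kl(2)] unfolding T_def by (rule tensor_mat_mult) (use c in auto)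
    then show "mat_adjoint (mat_adjoint (T k)) * mat_adjoint (T l) = (if k = l then E k \<otimes>\<^sub>m 1\<^sub>m m else 0\<^sub>m (?A * m) (?A * m))"
      using c EE[OF kl] Bc(3)[OF kl(1)] by (auto simp: zero_tensor_mat)
  qed
  have "mat_adjoint S * S = sum_mat (?A * m) (?A * m) (\<lambda>k. (cnj 1 * 1) \<cdot>\<^sub>m (mat_adjoint (T k) * T k)) {..<?A}"
    unfolding S_def by (rule sum_mat_adjoint_mult_orthogonal) (use T TT in auto)
  also have "\<dots> = sum_mat (?A * m) (?A * m) (\<lambda>k. E k \<otimes>\<^sub>m 1\<^sub>m m) {..<?A}"
    by (rule sum_mat_cong) (simp add: TT one_smult_mat del: mat_adjoint_adjoint)
  finally have 1: "mat_adjoint S * S = 1\<^sub>m (?A * m)" unfolding resolution .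
  have S': "mat_adjoint S = sum_mat (?A * m) (?A * m) (\<lambda>k. 1 \<cdot>\<^sub>m mat_adjoint (T k)) {..<?A}"
    unfolding S_def using T by (subst mat_adjoint_sum_mat) simp_all
  have "mat_adjoint (mat_adjoint S) * mat_adjoint S
      = sum_mat (?A * m) (?A * m) (\<lambda>k. (cnj 1 * 1) \<cdot>\<^sub>m (mat_adjoint (mat_adjoint (T k)) * mat_adjoint (T k))) {..<?A}"
    unfolding S' by (rule sum_mat_adjoint_mult_orthogonal) (use T TT in auto)
  also have "\<dots> = sum_mat (?A * m) (?A * m) (\<lambda>k. E k \<otimes>\<^sub>m 1\<^sub>m m) {..<?A}"
    by (rule sum_mat_cong) (simp add: TT one_smult_mat del: mat_adjoint_adjoint)
  finally have "S * mat_adjoint S = 1\<^sub>m (?A * m)" unfolding resolution by simp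
  then show ?thesis using S 1 ST by (auto simp: unitary_mat_def)
qed

text \<open>PREP is prescribed only on the all-zero state. With real entries the inner product of
  \<open>ket a 0\<close> and \<open>V\<close> is real, so a reflection exchanges them without an
  additional phase.\<close>

lemma exists_unitary_first_column:
  fixes V :: "complex mat"
  assumes V: "V \<in> carrier_mat (2 ^ a) 1" and norm: "mat_adjoint V * V = 1\<^sub>m 1"
    and real: "\<And>i. i < 2 ^ a \<Longrightarrow> cnj (V $$ (i, 0)) = V $$ (i, 0)"
  shows "\<exists>H. unitary_mat (2 ^ a) H \<and> H * ket a 0 = V"
proof (cases "V = ket a 0")
  case True
  then show ?thesis using V by (intro exI[of _ "1\<^sub>m (2 ^ a)"]) (simp add: unitary_mat_one)
next
  case False
  \<comment> \<open>Householder reflection exchanging the two real unit vectors.\<close>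
  define w where "w = ket a 0 - V"
  define x where "x = 1 - V $$ (0, 0)"
  define Q where "Q = (1 / (2 * x)) \<cdot>\<^sub>m (w * mat_adjoint w)"
  have e: "ket a 0 \<in> carrier_mat (2 ^ a) 1" and e': "mat_adjoint (ket a 0) \<in> carrier_mat 1 (2 ^ a)"
    by (simp_all only: mat_adjoint_carrier ket_carrier)
  have w: "w \<in> carrier_mat (2 ^ a) 1" unfolding w_def by (rule minus_carrier_mat[OF V])
  have w': "mat_adjoint w \<in> carrier_mat 1 (2 ^ a)" using w by (simp only: mat_adjoint_carrier)
  have V': "mat_adjoint V \<in> carrier_mat 1 (2 ^ a)" using V by (simp only: mat_adjoint_carrier)
  have adjw: "mat_adjoint w = mat_adjoint (ket a 0) - mat_adjoint V"
    unfolding w_def by (rule mat_adjoint_minus[OF e V])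
  have Ve: "mat_adjoint V * ket a 0 = V $$ (0, 0) \<cdot>\<^sub>m 1\<^sub>m 1"
    unfolding mult_ket[OF V' zero_less_power[OF zero_less_numeral]] using V real[of 0] by (intro eq_matI) auto
  have eV: "mat_adjoint (ket a 0) * V = V $$ (0, 0) \<cdot>\<^sub>m 1\<^sub>m 1"
  proof -
    have "mat_adjoint (ket a 0) * V = mat_adjoint (mat_adjoint V * ket a 0)"
      using V by (subst mat_adjoint_mult) auto
    then show ?thesis unfolding Ve using real[of 0] by simp
  qed
  have ee: "mat_adjoint (ket a 0) * ket a 0 = 1\<^sub>m 1" by (simp add: ket_inner)
  have we: "mat_adjoint w * ket a 0 = x \<cdot>\<^sub>m 1\<^sub>m 1"
    unfolding adjw minus_mult_distrib_mat[OF e' V' e] ee Ve x_def by (rule eq_matI) auto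
  have wV: "mat_adjoint w * V = (- x) \<cdot>\<^sub>m 1\<^sub>m 1"
    unfolding adjw minus_mult_distrib_mat[OF e' V' V] norm eV x_def by (rule eq_matI) auto
  \<comment> \<open>Both vectors have length 1, so \<open>w\<close> has squared length
    \<open>2 * x\<close>; this makes \<open>Q\<close> the projector onto the line of
    \<open>w\<close>.\<close>
  have "mat_adjoint w * w = mat_adjoint w * ket a 0 - mat_adjoint w * V"
    by (subst (2) w_def) (rule mult_minus_distrib_mat[OF w' e V])
  also have "\<dots> = (2 * x) \<cdot>\<^sub>m 1\<^sub>m 1" unfolding we wV by (rule eq_matI) auto
  finally have ww: "mat_adjoint w * w = (2 * x) \<cdot>\<^sub>m 1\<^sub>m 1" .
  \<comment> \<open>If \<open>x\<close> were zero, \<open>w\<close> would have length zero and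
    \<open>V\<close> would be \<open>ket a 0\<close>, the case already settled.\<close>
  have x0: "x \<noteq> 0"
  proof
    assume "x = 0"
    have "(mat_adjoint w * w) $$ (0, 0) = (\<Sum>i\<in>{0..<2 ^ a}. cnj (w $$ (i, 0)) * w $$ (i, 0))"
      using w by (simp add: scalar_prod_def)
    also have "\<dots> = (\<Sum>i\<in>{0..<2 ^ a}. complex_of_real ((cmod (w $$ (i, 0)))\<^sup>2))"
      by (intro sum.cong refl) (simp only: complex_norm_square mult.commute)
    finally have "(mat_adjoint w * w) $$ (0, 0) = complex_of_real (\<Sum>i\<in>{0..<2 ^ a}. (cmod (w $$ (i, 0)))\<^sup>2)"
      by (simp only: of_real_sum)
    then have "complex_of_real (\<Sum>i\<in>{0..<2 ^ a}. (cmod (w $$ (i, 0)))\<^sup>2) = 0"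
      unfolding ww using \<open>x = 0\<close> by simp
    then have "(\<Sum>i\<in>{0..<2 ^ a}. (cmod (w $$ (i, 0)))\<^sup>2) = 0" by (simp only: of_real_eq_0_iff)
    then have w0: "w $$ (i, 0) = 0" if "i < 2 ^ a" for i
      using that by (subst (asm) sum_nonneg_eq_0_iff) auto
    have "ket a 0 - V = 0\<^sub>m (2 ^ a) 1"
      unfolding w_def[symmetric] using w w0 by (intro eq_matI) auto
    then show False using False mat_minus_eq_zero_iff[OF e V] by simp
  qed
  have cx: "cnj x = x" unfolding x_def using real[of 0] by simp
  have wwc: "w * mat_adjoint w \<in> carrier_mat (2 ^ a) (2 ^ a)" by (rule mult_carrier_mat[OF w w'])
  have Q: "Q \<in> carrier_mat (2 ^ a) (2 ^ a)" unfolding Q_def by (rule smult_carrier_mat[OF wwc])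
  have herm: "hermitian_mat (2 ^ a) Q"
    using Q by (simp add: hermitian_mat_def Q_def mat_adjoint_mult cx)
  have "w * mat_adjoint w * (w * mat_adjoint w) = w * ((mat_adjoint w * w) * mat_adjoint w)"
    by (simp only: assoc_mult_mat[OF w w' wwc] assoc_mult_mat[OF w' w w'])
  also have "\<dots> = (2 * x) \<cdot>\<^sub>m (w * mat_adjoint w)"
    unfolding ww by (simp only: mult_smult_assoc_mat[OF one_carrier_mat w'] left_mult_one_mat[OF w'] mult_smult_distrib[OF w w'])
  finally have "Q * Q = (1 / (2 * x) * (1 / (2 * x) * (2 * x))) \<cdot>\<^sub>m (w * mat_adjoint w)"
    unfolding Q_def by (simp only: mult_smult_assoc_mat[OF wwc smult_carrier_mat[OF wwc]] mult_smult_distrib[OF wwc wwc]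
      smult_smult_mat)
  then have "Q * Q = Q" unfolding Q_def using x0 by simp
  then have H: "unitary_mat (2 ^ a) (1\<^sub>m (2 ^ a) - 2 \<cdot>\<^sub>m Q)"
    by (rule hermitian_idempotent_reflection[OF herm])
  \<comment> \<open>The component of \<open>ket a 0\<close> along \<open>w\<close> is half of
    \<open>w\<close>, so the reflection subtracts exactly \<open>w\<close>.\<close>
  have "w * mat_adjoint w * ket a 0 = x \<cdot>\<^sub>m w"
    by (simp only: assoc_mult_mat[OF w w' e] we mult_smult_distrib[OF w one_carrier_mat] right_mult_one_mat[OF w])
  then have "2 \<cdot>\<^sub>m Q * ket a 0 = (2 * (1 / (2 * x) * x)) \<cdot>\<^sub>m w"
    unfolding Q_def by (simp only: smult_smult_mat mult_smult_assoc_mat[OF wwc e] mult.assoc)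
  then have Qe: "2 \<cdot>\<^sub>m Q * ket a 0 = w" using x0 w by (intro eq_matI) auto
  have "(1\<^sub>m (2 ^ a) - 2 \<cdot>\<^sub>m Q) * ket a 0 = ket a 0 - w"
    by (simp only: minus_mult_distrib_mat[OF one_carrier_mat smult_carrier_mat[OF Q] e] left_mult_one_mat[OF e] Qe)
  also have "\<dots> = V" unfolding w_def using V by (intro eq_matI) auto
  finally show ?thesis using H by blast
qed

text \<open>The squared amplitudes are the weights divided by their sum, and an injective labelling
  keeps the kets orthogonal; the prescribed state is therefore a real unit vector.\<close>

lemma exists_prep:
  assumes inj: "inj_on c {..<R}" and c: "\<And>\<xi>. \<xi> < R \<Longrightarrow> c \<xi> < 2 ^ a" and pos: "weight_norm R lam > 0"
  shows "\<exists>PREP. is_prep a c R lam PREP"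
proof -
  define q where "q \<xi> = complex_of_real (1 / sqrt (weight_norm R lam)) * complex_of_real (sqrt \<bar>lam \<xi>\<bar>)" for \<xi>
  define V where "V = sum_mat (2 ^ a) 1 (\<lambda>\<xi>. q \<xi> \<cdot>\<^sub>m ket a (c \<xi>)) {..<R}"
  have "mat_adjoint V * V
      = sum_mat 1 1 (\<lambda>\<xi>. (cnj (q \<xi>) * q \<xi>) \<cdot>\<^sub>m (mat_adjoint (ket a (c \<xi>)) * ket a (c \<xi>))) {..<R}"
    unfolding V_def
  proof (rule sum_mat_adjoint_mult_orthogonal)
    fix x y assume "x \<in> {..<R}" "y \<in> {..<R}" "x \<noteq> y"
    then show "mat_adjoint (ket a (c x)) * ket a (c y) = 0\<^sub>m 1 1"
      using inj c[of x] c[of y] by (auto simp: ket_inner dest: inj_onD)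
  qed (simp_all only: finite_lessThan ket_carrier)
  also have "\<dots> = sum_mat 1 1 (\<lambda>\<xi>. complex_of_real (\<bar>lam \<xi>\<bar> / weight_norm R lam) \<cdot>\<^sub>m 1\<^sub>m 1) {..<R}"
  proof (rule sum_mat_cong)
    fix x assume "x \<in> {..<R}"
    moreover have "cnj (q x) * q x = complex_of_real (\<bar>lam x\<bar> / weight_norm R lam)"
      unfolding q_def by (rule prep_amplitude_square[OF pos])
    ultimately show "(cnj (q x) * q x) \<cdot>\<^sub>m (mat_adjoint (ket a (c x)) * ket a (c x))
        = complex_of_real (\<bar>lam x\<bar> / weight_norm R lam) \<cdot>\<^sub>m 1\<^sub>m 1"
      using c[of x] by (simp add: ket_inner)
  qed
  also have "\<dots> = 1\<^sub>m 1"
  proof (rule eq_matI)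
    fix i j assume "i < dim_row (1\<^sub>m 1 :: complex mat)" "j < dim_col (1\<^sub>m 1 :: complex mat)"
    moreover have "(\<Sum>\<xi><R. complex_of_real (\<bar>lam \<xi>\<bar> / weight_norm R lam)) = 1"
      using pos by (simp add: weight_norm_def flip: of_real_sum sum_divide_distrib)
    ultimately show "sum_mat 1 1 (\<lambda>\<xi>. complex_of_real (\<bar>lam \<xi>\<bar> / weight_norm R lam) \<cdot>\<^sub>m 1\<^sub>m 1) {..<R} $$ (i, j) = 1\<^sub>m 1 $$ (i, j)"
      by simp
  qed auto
  finally have norm: "mat_adjoint V * V = 1\<^sub>m 1" .
  have real: "cnj (V $$ (i, 0)) = V $$ (i, 0)" if "i < 2 ^ a" for i
    using that unfolding V_def q_def by (auto intro!: sum.cong)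
  have "V \<in> carrier_mat (2 ^ a) 1" by (simp only: V_def sum_mat_carrier)
  then obtain H where "unitary_mat (2 ^ a) H" "H * ket a 0 = V"
    using exists_unitary_first_column[OF _ norm real] by blast
  then have "is_prep a c R lam H"
    unfolding is_prep_def V_def q_def
    by (simp only: smult_sum_mat[OF smult_carrier_mat[OF ket_carrier]] smult_smult_mat simp_thms)
  then show ?thesis ..
qed

lemma unitary_mat_branch_sign:
  assumes "unitary_mat d A"
  shows "unitary_mat d (branch_sign x \<cdot>\<^sub>m A)"
  using unitary_matD[OF assms] mat_adjoint_carrier[of A d d]
  by (simp add: unitary_mat_def mult_smult_assoc_mat[of _ d d _ d] mult_smult_distrib[of _ d d _ d]
    smult_smult_mat branch_sign_square) (auto intro!: eq_matI)

lemma exists_select: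
  assumes inj: "inj_on c {..<R}" and c: "\<And>\<xi>. \<xi> < R \<Longrightarrow> c \<xi> < 2 ^ a"
    and W: "\<And>\<xi>. \<xi> < R \<Longrightarrow> unitary_mat (2 * 2 ^ n) (W \<xi>)"
  shows "\<exists>SELECT. is_select n a c R lam W SELECT"
proof -
  \<comment> \<open>The inverse of the labelling recovers the mode of a label; every other basis
    state receives the identity.\<close>
  define B where "B k = (if k \<in> c ` {..<R}
    then (let \<xi> = inv_into {..<R} c k in branch_sign (lam \<xi>) \<cdot>\<^sub>m W \<xi>) else 1\<^sub>m (2 * 2 ^ n))" for k
  have "inv_into {..<R} c k < R" if "k \<in> c ` {..<R}" for k
    using inv_into_into[OF that] by simp
  then have "unitary_mat (2 * 2 ^ n) (B k)" for k
    unfolding B_def by (auto simp: Let_def unitary_mat_one intro!: unitary_mat_branch_sign W)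
  then obtain S where S: "unitary_mat (2 ^ a * (2 * 2 ^ n)) S"
    and SB: "\<And>k. k < 2 ^ a \<Longrightarrow> S * (ket a k \<otimes>\<^sub>m 1\<^sub>m (2 * 2 ^ n)) = ket a k \<otimes>\<^sub>m B k"
    using exists_block_diagonal_unitary[of a "2 * 2 ^ n" B] by blast
  have "B (c \<xi>) = branch_sign (lam \<xi>) \<cdot>\<^sub>m W \<xi>" if "\<xi> < R" for \<xi>
    using that inj by (simp add: B_def inv_into_f_f)
  moreover have "B k = 1\<^sub>m (2 * 2 ^ n)" if "k \<notin> c ` {..<R}" for k
    using that by (simp add: B_def)
  ultimately have "is_select n a c R lam W S"
    unfolding is_select_def using S SB c by auto
  then show ?thesis ..
qed

section \<open>Rotated modes\<close>

lemma rotated_creation_adjoint: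
  "mat_adjoint (rotated_creation n U \<xi>) = sum_mat (2 ^ n) (2 ^ n) (\<lambda>p. cnj (U $$ (p, \<xi>)) \<cdot>\<^sub>m annihilation n p) {..<n}"
  unfolding rotated_creation_def by (subst mat_adjoint_sum_mat) (simp_all add: creation_def)

lemma rotated_creation_carrier [simp]: "rotated_creation n U \<xi> \<in> carrier_mat (2 ^ n) (2 ^ n)"
  by (simp add: rotated_creation_def)

lemma mode_occupation_carrier [simp]: "mode_occupation n U \<xi> \<in> carrier_mat (2 ^ n) (2 ^ n)"
  unfolding mode_occupation_def
  by (intro mult_carrier_mat[of _ _ "2 ^ n"]) simp_all

lemma rotated_annihilation_anticommute:
  "mat_adjoint (rotated_creation n U \<xi>) * mat_adjoint (rotated_creation n U \<eta>)
    + mat_adjoint (rotated_creation n U \<eta>) * mat_adjoint (rotated_creation n U \<xi>) = 0\<^sub>m (2 ^ n) (2 ^ n)"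
  unfolding rotated_creation_adjoint
  by (subst sum_mat_anticommutator[where h = "\<lambda>_ _. 0"]) (simp_all add: annihilation_anticommute, auto intro!: eq_matI)

text \<open>The adjoint of the relation for annihilators.\<close>

lemma rotated_creation_anticommute:
  "rotated_creation n U \<xi> * rotated_creation n U \<eta> + rotated_creation n U \<eta> * rotated_creation n U \<xi> = 0\<^sub>m (2 ^ n) (2 ^ n)"
proof -
  let ?d = "2 ^ n :: nat" and ?c = "rotated_creation n U"
  have c: "?c \<xi> \<in> carrier_mat ?d ?d" "?c \<eta> \<in> carrier_mat ?d ?d" by simp_all
  have c': "mat_adjoint (?c \<xi>) \<in> carrier_mat ?d ?d" "mat_adjoint (?c \<eta>) \<in> carrier_mat ?d ?d" using c by simp_all
  have "mat_adjoint (mat_adjoint (?c \<eta>) * mat_adjoint (?c \<xi>) + mat_adjoint (?c \<xi>) * mat_adjoint (?c \<eta>))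
      = ?c \<xi> * ?c \<eta> + ?c \<eta> * ?c \<xi>"
    unfolding mat_adjoint_add[OF mult_carrier_mat[OF c'(2,1)] mult_carrier_mat[OF c'(1,2)]]
    using carrier_matD[OF c(1)] carrier_matD[OF c(2)] by (simp add: mat_adjoint_mult)
  then show ?thesis
    unfolding rotated_annihilation_anticommute mat_adjoint_zero by (rule sym)
qed

text \<open>The delta of the orbitals collapses the double sum to an entry of
  \<open>mat_adjoint U * U\<close>, so the relation says that the columns of \<open>U\<close> are
  orthonormal.\<close>

lemma rotated_annihilation_creation_anticommute:
  assumes U: "unitary_mat n U" and \<xi>: "\<xi> < n" and \<eta>: "\<eta> < n"
  shows "mat_adjoint (rotated_creation n U \<xi>) * rotated_creation n U \<eta>
    + rotated_creation n U \<eta> * mat_adjoint (rotated_creation n U \<xi>) = (if \<xi> = \<eta> then 1 else 0) \<cdot>\<^sub>m 1\<^sub>m (2 ^ n)"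
proof -
  have cU: "U \<in> carrier_mat n n" and UU: "mat_adjoint U * U = 1\<^sub>m n" using unitary_matD[OF U] by auto
  have "(\<Sum>p<n. \<Sum>q<n. cnj (U $$ (p, \<xi>)) * U $$ (q, \<eta>) * (if p = q then 1 else 0))
      = (\<Sum>p<n. cnj (U $$ (p, \<xi>)) * U $$ (p, \<eta>))"
  proof (rule sum.cong)
    fix p assume "p \<in> {..<n}"
    then show "(\<Sum>q<n. cnj (U $$ (p, \<xi>)) * U $$ (q, \<eta>) * (if p = q then 1 else 0)) = cnj (U $$ (p, \<xi>)) * U $$ (p, \<eta>)"
      by (subst sum_eq_single[of _ p]) auto
  qed simp
  also have "\<dots> = (mat_adjoint U * U) $$ (\<xi>, \<eta>)"
    using cU \<xi> \<eta> by (simp add: scalar_prod_def atLeast0LessThan)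
  also have "\<dots> = (if \<xi> = \<eta> then 1 else 0)" unfolding UU using \<xi> \<eta> by simp
  finally have *: "(\<Sum>p<n. \<Sum>q<n. cnj (U $$ (p, \<xi>)) * U $$ (q, \<eta>) * (if p = q then 1 else 0)) = (if \<xi> = \<eta> then 1 else 0)" .
  show ?thesis
    unfolding rotated_creation_adjoint unfolding rotated_creation_def
    by (subst sum_mat_anticommutator[where h = "\<lambda>p q. if p = q then 1 else 0"])
      (simp_all only: * lessThan_iff annihilation_carrier creation_carrier annihilation_creation_anticommute)
qed

lemma mode_occupation_hermitian: "mat_adjoint (mode_occupation n U \<xi>) = mode_occupation n U \<xi>"
  by (simp add: mode_occupation_def mat_adjoint_mult)

lemma mode_occupation_idempotent:
  assumes "unitary_mat n U" "\<xi> < n"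
  shows "mode_occupation n U \<xi> * mode_occupation n U \<xi> = mode_occupation n U \<xi>"
  unfolding mode_occupation_def
  by (rule number_operator_idempotent[of _ "2 ^ n"])
    (simp_all add: rotated_annihilation_anticommute rotated_annihilation_creation_anticommute[OF assms assms(2)] one_smult_mat)

lemma mode_occupation_commute:
  assumes U: "unitary_mat n U" and \<xi>: "\<xi> < n" and \<eta>: "\<eta> < n"
  shows "mode_occupation n U \<xi> * mode_occupation n U \<eta> = mode_occupation n U \<eta> * mode_occupation n U \<xi>"
proof (cases "\<xi> = \<eta>")
  \<comment> \<open>The commutation lemma needs vanishing mixed anticommutators, which hold for
    distinct modes only.\<close>
  case False
  have z: "0 \<cdot>\<^sub>m 1\<^sub>m d = (0\<^sub>m d d :: complex mat)" for d by (rule eq_matI) auto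
  show ?thesis
    unfolding mode_occupation_def
    by (rule number_operators_commute[of _ "2 ^ n"])
      (use False in \<open>simp_all add: rotated_annihilation_anticommute rotated_creation_anticommute
        rotated_annihilation_creation_anticommute[OF U \<xi> \<eta>] rotated_annihilation_creation_anticommute[OF U \<eta> \<xi>] z\<close>)
qed simp

text \<open>Expanded in the orbitals, the occupation is a combination of hops, each of which
  conserves the particle number.\<close>

lemma sector_projector_commute_mode_occupation:
  "sector_projector n N * mode_occupation n U \<xi> = mode_occupation n U \<xi> * sector_projector n N"
proof -
  let ?d = "2 ^ n :: nat" and ?P = "sector_projector n N"
  define u where "u p = U $$ (p, \<xi>)" for p
  define B where "B = sum_mat ?d ?d (\<lambda>q. cnj (u q) \<cdot>\<^sub>m annihilation n q) {..<n}"
  have P: "?P \<in> carrier_mat ?d ?d" by simp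
  have ca: "creation n p * annihilation n q \<in> carrier_mat ?d ?d" for p q
    by (rule mult_carrier_mat[OF creation_carrier annihilation_carrier])
  have "mode_occupation n U \<xi> = sum_mat ?d ?d (\<lambda>p. u p \<cdot>\<^sub>m creation n p) {..<n} * B"
    unfolding mode_occupation_def rotated_creation_adjoint B_def u_def by (simp add: rotated_creation_def)
  also have "\<dots> = sum_mat ?d ?d (\<lambda>p. (u p \<cdot>\<^sub>m creation n p) * B) {..<n}"
    by (rule sum_mat_mult) (simp_all add: B_def)
  also have "\<dots> = sum_mat ?d ?d (\<lambda>p. sum_mat ?d ?d (\<lambda>q. (u p * cnj (u q)) \<cdot>\<^sub>m (creation n p * annihilation n q)) {..<n}) {..<n}"
  proof (rule sum_mat_cong)
    fix p
    have "(u p \<cdot>\<^sub>m creation n p) * B = sum_mat ?d ?d (\<lambda>q. (u p \<cdot>\<^sub>m creation n p) * (cnj (u q) \<cdot>\<^sub>m annihilation n q)) {..<n}"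
      unfolding B_def by (rule mult_sum_mat) simp_all
    then show "(u p \<cdot>\<^sub>m creation n p) * B = sum_mat ?d ?d (\<lambda>q. (u p * cnj (u q)) \<cdot>\<^sub>m (creation n p * annihilation n q)) {..<n}"
      by (simp only: mult_smult_assoc_mat[OF creation_carrier smult_carrier_mat[OF annihilation_carrier]]
        mult_smult_distrib[OF creation_carrier annihilation_carrier] smult_smult_mat)
  qed
  finally have occ: "mode_occupation n U \<xi> = sum_mat ?d ?d (\<lambda>p. sum_mat ?d ?d
      (\<lambda>q. (u p * cnj (u q)) \<cdot>\<^sub>m (creation n p * annihilation n q)) {..<n}) {..<n}" .
  have "?P * mode_occupation n U \<xi> = sum_mat ?d ?d (\<lambda>p. sum_mat ?d ?d
      (\<lambda>q. ?P * ((u p * cnj (u q)) \<cdot>\<^sub>m (creation n p * annihilation n q))) {..<n}) {..<n}"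
    unfolding occ
    by (simp only: mult_sum_mat[OF P sum_mat_carrier] mult_sum_mat[OF P smult_carrier_mat[OF ca]])
  also have "\<dots> = sum_mat ?d ?d (\<lambda>p. sum_mat ?d ?d
      (\<lambda>q. ((u p * cnj (u q)) \<cdot>\<^sub>m (creation n p * annihilation n q)) * ?P) {..<n}) {..<n}"
    by (intro sum_mat_cong) (simp only: lessThan_iff mult_smult_distrib[OF P ca] mult_smult_assoc_mat[OF ca P]
      sector_projector_commute_hop)
  also have "\<dots> = mode_occupation n U \<xi> * ?P"
    unfolding occ
    by (simp only: sum_mat_mult[OF P sum_mat_carrier] sum_mat_mult[OF P smult_carrier_mat[OF ca]])
  finally show ?thesis .
qed

section \<open>Transport from Fock space to qubits\<close>

lemma on_qubits_carrier [simp]: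
  "V \<in> carrier_mat d d \<Longrightarrow> X \<in> carrier_mat d d \<Longrightarrow> on_qubits V X \<in> carrier_mat d d"
  by (simp add: on_qubits_def mult_carrier_mat[of _ d d _ d])

lemma on_qubits_mult:
  assumes V: "unitary_mat d V" and X: "X \<in> carrier_mat d d" and Y: "Y \<in> carrier_mat d d"
  shows "on_qubits V X * on_qubits V Y = on_qubits V (X * Y)"
proof -
  have c: "V \<in> carrier_mat d d" and c': "mat_adjoint V \<in> carrier_mat d d" and VV: "mat_adjoint V * V = 1\<^sub>m d"
    using unitary_matD[OF V] by simp_all
  have YV: "Y * mat_adjoint V \<in> carrier_mat d d" by (rule mult_carrier_mat[OF Y c'])
  have "mat_adjoint V * (V * (Y * mat_adjoint V)) = Y * mat_adjoint V"
    by (rule adjoint_mult_cancel[OF VV c YV])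
  then show ?thesis
    unfolding on_qubits_def using c c' X Y YV
    by (simp add: assoc_mult_mat[of _ d d _ d _ d])
qed

lemma on_qubits_adjoint:
  assumes "V \<in> carrier_mat d d" "X \<in> carrier_mat d d"
  shows "mat_adjoint (on_qubits V X) = on_qubits V (mat_adjoint X)"
  using assms unfolding on_qubits_def
  by (simp add: mat_adjoint_mult assoc_mult_mat[of _ d d _ d _ d])

lemma on_qubits_sum_mat:
  assumes V: "V \<in> carrier_mat d d" and f: "\<And>x. x \<in> I \<Longrightarrow> f x \<in> carrier_mat d d"
  shows "on_qubits V (sum_mat d d (\<lambda>x. u x \<cdot>\<^sub>m f x) I) = sum_mat d d (\<lambda>x. u x \<cdot>\<^sub>m on_qubits V (f x)) I"
proof -
  have V': "mat_adjoint V \<in> carrier_mat d d" using V by simp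
  have Vf: "V * f x \<in> carrier_mat d d" if "x \<in> I" for x by (rule mult_carrier_mat[OF V f[OF that]])
  have "V * sum_mat d d (\<lambda>x. u x \<cdot>\<^sub>m f x) I = sum_mat d d (\<lambda>x. V * (u x \<cdot>\<^sub>m f x)) I"
    by (rule mult_sum_mat[OF V smult_carrier_mat[OF f]])
  also have "\<dots> = sum_mat d d (\<lambda>x. u x \<cdot>\<^sub>m (V * f x)) I"
    by (rule sum_mat_cong) (rule mult_smult_distrib[OF V f])
  finally have "on_qubits V (sum_mat d d (\<lambda>x. u x \<cdot>\<^sub>m f x) I) = sum_mat d d (\<lambda>x. u x \<cdot>\<^sub>m (V * f x)) I * mat_adjoint V"
    unfolding on_qubits_def by simp
  also have "\<dots> = sum_mat d d (\<lambda>x. (u x \<cdot>\<^sub>m (V * f x)) * mat_adjoint V) I"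
    by (rule sum_mat_mult[OF V' smult_carrier_mat[OF Vf]])
  also have "\<dots> = sum_mat d d (\<lambda>x. u x \<cdot>\<^sub>m on_qubits V (f x)) I"
    unfolding on_qubits_def by (rule sum_mat_cong) (rule mult_smult_assoc_mat[OF Vf V'])
  finally show ?thesis .
qed

section \<open>The block encodings of the weighted occupation\<close>

text \<open>The two outer factors may differ, so taking one of them to be the identity covers
  one-sided products.\<close>

lemma sandwich_sum_mat:
  assumes P: "P \<in> carrier_mat d d" and P': "P' \<in> carrier_mat d d" and f: "\<And>x. x \<in> I \<Longrightarrow> f x \<in> carrier_mat d d"
  shows "P * sum_mat d d (\<lambda>x. u x \<cdot>\<^sub>m f x) I * P' = sum_mat d d (\<lambda>x. u x \<cdot>\<^sub>m (P * f x * P')) I"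
proof -
  have Pf: "P * f x \<in> carrier_mat d d" if "x \<in> I" for x by (rule mult_carrier_mat[OF P f[OF that]])
  have "P * sum_mat d d (\<lambda>x. u x \<cdot>\<^sub>m f x) I = sum_mat d d (\<lambda>x. P * (u x \<cdot>\<^sub>m f x)) I"
    by (rule mult_sum_mat[OF P smult_carrier_mat[OF f]])
  also have "\<dots> = sum_mat d d (\<lambda>x. u x \<cdot>\<^sub>m (P * f x)) I"
    by (rule sum_mat_cong) (rule mult_smult_distrib[OF P f])
  also have "\<dots> * P' = sum_mat d d (\<lambda>x. (u x \<cdot>\<^sub>m (P * f x)) * P') I"
    by (rule sum_mat_mult[OF P' smult_carrier_mat[OF Pf]])
  also have "\<dots> = sum_mat d d (\<lambda>x. u x \<cdot>\<^sub>m (P * f x * P')) I"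
    by (rule sum_mat_cong) (rule mult_smult_assoc_mat[OF Pf P'])
  finally show ?thesis .
qed

text \<open>Absence of leakage together with the block equation gives
  \<open>E * P = k \<cdot>\<^sub>m (Q * P)\<close>, and the left-hand side is the adjoint of
  \<open>E * P\<close> times \<open>E * P\<close>. Nothing is required of \<open>E\<close> outside
  the range of \<open>P\<close>.\<close>

lemma square_block:
  fixes P Q E :: "complex mat"
  assumes P: "P \<in> carrier_mat d d" and Q: "Q \<in> carrier_mat d d" and E: "E \<in> carrier_mat d d"
    and adj: "mat_adjoint P = P" "mat_adjoint Q = Q" "cnj k = k" and PP: "P * P = P" and PQ: "P * Q = Q * P"
    and leak: "E * P = P * E * P" and block: "P * E * P = k \<cdot>\<^sub>m (P * Q * P)"
  shows "P * (mat_adjoint E * E) * P = (k * k) \<cdot>\<^sub>m (P * (Q * Q) * P)"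
proof -
  have QP: "Q * P \<in> carrier_mat d d" by (rule mult_carrier_mat[OF Q P])
  have E': "mat_adjoint E \<in> carrier_mat d d" using E by simp
  have "P * Q * P = Q * P" by (simp only: PQ assoc_mult_mat[OF Q P P] PP)
  then have EP: "E * P = k \<cdot>\<^sub>m (Q * P)" using leak block by simp
  have adjEP: "mat_adjoint (E * P) = P * mat_adjoint E" using E P adj by (simp add: mat_adjoint_mult)
  have adjQP: "mat_adjoint (Q * P) = P * Q" using Q P adj by (simp add: mat_adjoint_mult)
  have "P * (mat_adjoint E * E) * P = (P * mat_adjoint E) * (E * P)"
    by (simp only: assoc_mult_mat[OF P mult_carrier_mat[OF E' E] P] assoc_mult_mat[OF E' E P]
      assoc_mult_mat[OF P E' mult_carrier_mat[OF E P]])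
  also have "\<dots> = (k \<cdot>\<^sub>m (P * Q)) * (k \<cdot>\<^sub>m (Q * P))"
    unfolding adjEP[symmetric] EP by (simp add: adjQP adj)
  also have "\<dots> = (k * k) \<cdot>\<^sub>m ((P * Q) * (Q * P))"
    by (simp only: mult_smult_assoc_mat[OF mult_carrier_mat[OF P Q] smult_carrier_mat[OF QP]]
      mult_smult_distrib[OF mult_carrier_mat[OF P Q] QP] smult_smult_mat)
  also have "(P * Q) * (Q * P) = P * (Q * Q) * P"
    by (simp only: assoc_mult_mat[OF P Q QP] assoc_mult_mat[OF Q Q P] assoc_mult_mat[OF P mult_carrier_mat[OF Q Q] P])
  finally show ?thesis .
qed

lemma index_labelling_less:
  assumes "index_labelling reg R c" "\<xi> < R"
  shows "c \<xi> < 2 ^ index_qubits reg R"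
  using assms by (cases reg) (auto simp: index_labelling_def)

lemma encoded_block_flag_reflection:
  assumes X: "X \<in> carrier_mat (2 ^ n) (2 ^ n)"
  shows "encoded_block n 1 (flag_reflection (2 ^ n) X) = X"
  unfolding encoded_block_def flag_reflection_compress[OF X one_carrier_mat] using X by simp

text \<open>The circuit is chosen before the operator data, so it cannot depend on the weights. The
  clause producing \<open>PREP\<close>, \<open>W\<close> and \<open>SELECT\<close> shows that the
  last clause, about all such triples, is not vacuous. Leakage is restricted for the squaring step
  only, and one unitary \<open>X\<close> serves all sectors at once.\<close>

theorem lemma2:
  fixes n R a :: nat and reg :: index_register
  assumes R: "1 \<le> R" "R \<le> n"
    and a: "a = index_qubits reg R"
  shows "\<exists>C. qsvt2_wf (a + 1) C \<and> qsvt2_implements_square n (a + 1) C \<and>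
    (\<forall>(V :: complex mat) (L :: complex mat) (U :: complex mat) (lam :: nat \<Rightarrow> real) (c :: nat \<Rightarrow> nat)
       Proj num Ohat \<Gamma>.
      unitary_mat (2 ^ n) V \<longrightarrow>
      hermitian_mat n L \<longrightarrow> unitary_mat n U \<longrightarrow>
      L = U * mat_diag n (\<lambda>i. complex_of_real (lam i)) * mat_adjoint U \<longrightarrow>
      index_labelling reg R c \<longrightarrow>
      Proj = (\<lambda>Ne. on_qubits V (sector_projector n Ne)) \<longrightarrow>
      num = (\<lambda>\<xi>. on_qubits V (mode_occupation n U \<xi>)) \<longrightarrow>
      Ohat = on_qubits V (weighted_occupation n R U lam) \<longrightarrow>
      \<Gamma> = weight_norm R lam \<longrightarrow> \<Gamma> > 0 \<longrightarrow>
      (\<exists>X. \<forall>Ne. block_encoding (Proj Ne) n (\<Gamma>\<^sup>2) (a + 2) 0 X (Ohat * Ohat)) \<and>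
      (\<forall>\<xi><R. hermitian_mat (2 ^ n) (num \<xi>) \<and> num \<xi> * num \<xi> = num \<xi> \<and>
         (\<forall>\<eta><R. num \<xi> * num \<eta> = num \<eta> * num \<xi>)) \<and>
      (\<exists>PREP W SELECT. is_prep a c R lam PREP \<and> is_select n a c R lam W SELECT \<and>
         (\<forall>Ne. \<forall>\<xi><R. block_encoding (Proj Ne) n 1 1 0 (W \<xi>) (num \<xi>) \<and>
                       no_leakage (Proj Ne) n (W \<xi>))) \<and>
      (\<forall>PREP W SELECT Ne.
         is_prep a c R lam PREP \<longrightarrow> is_select n a c R lam W SELECT \<longrightarrow>
         (\<forall>\<xi><R. block_encoding (Proj Ne) n 1 1 0 (W \<xi>) (num \<xi>)) \<longrightarrow>
         block_encoding (Proj Ne) n \<Gamma> (a + 1) 0 (prep_select_prep n PREP SELECT) Ohat \<and>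
         ((\<forall>\<xi><R. no_leakage (Proj Ne) n (W \<xi>)) \<longrightarrow>
           block_encoding (Proj Ne) n (\<Gamma>\<^sup>2) (a + 2) 0
             (qsvt2_apply n C (prep_select_prep n PREP SELECT)) (Ohat * Ohat))))"
proof (intro exI[of _ "square_circuit (a + 1)"] conjI square_circuit_wf square_circuit_implements_square,
    intro allI impI, goal_cases main)
  case (main V L U lam c Proj num Ohat \<Gamma>)
  let ?d = "2 ^ n :: nat"
  note V = main(1) and U = main(3) and lab = main(5) and Proj = main(6) and num = main(7)
    and Ohat = main(8) and \<Gamma> = main(9) and pos = main(10)
  have cV: "V \<in> carrier_mat ?d ?d" using unitary_matD[OF V] by simp
  have inj: "inj_on c {..<R}" using lab by (simp add: index_labelling_def)
  have c: "c \<xi> < 2 ^ a" if "\<xi> < R" for \<xi>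
    unfolding a by (rule index_labelling_less[OF lab that])
  have pos': "weight_norm R lam > 0" using pos \<Gamma> by simp
  have P: "Proj Ne \<in> carrier_mat ?d ?d" for Ne
    unfolding Proj by (rule on_qubits_carrier[OF cV sector_projector_carrier])
  have adjP: "mat_adjoint (Proj Ne) = Proj Ne" for Ne
    unfolding Proj on_qubits_adjoint[OF cV sector_projector_carrier] sector_projector_hermitian ..
  have PP: "Proj Ne * Proj Ne = Proj Ne" for Ne
    unfolding Proj on_qubits_mult[OF V sector_projector_carrier sector_projector_carrier] sector_projector_idempotent ..
  have N: "num \<xi> \<in> carrier_mat ?d ?d" for \<xi>
    unfolding num by (rule on_qubits_carrier[OF cV mode_occupation_carrier])
  have adjN: "mat_adjoint (num \<xi>) = num \<xi>" for \<xi>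
    unfolding num on_qubits_adjoint[OF cV mode_occupation_carrier] mode_occupation_hermitian ..
  have NN: "num \<xi> * num \<xi> = num \<xi>" if "\<xi> < R" for \<xi>
    unfolding num on_qubits_mult[OF V mode_occupation_carrier mode_occupation_carrier]
    using mode_occupation_idempotent[OF U, of \<xi>] that R by simp
  have NNc: "num \<xi> * num \<eta> = num \<eta> * num \<xi>" if "\<xi> < R" "\<eta> < R" for \<xi> \<eta>
    unfolding num on_qubits_mult[OF V mode_occupation_carrier mode_occupation_carrier]
    using mode_occupation_commute[OF U, of \<xi> \<eta>] that R by simp
  have PN: "Proj Ne * num \<xi> = num \<xi> * Proj Ne" for Ne \<xi>
    unfolding Proj num on_qubits_mult[OF V sector_projector_carrier mode_occupation_carrier]
      on_qubits_mult[OF V mode_occupation_carrier sector_projector_carrier] sector_projector_commute_mode_occupation ..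
  have hermN: "hermitian_mat ?d (num \<xi>)" for \<xi> using N adjN by (simp add: hermitian_mat_def)
  have O_sum: "Ohat = sum_mat ?d ?d (\<lambda>\<xi>. complex_of_real (lam \<xi>) \<cdot>\<^sub>m num \<xi>) {..<R}"
    unfolding Ohat num weighted_occupation_def by (rule on_qubits_sum_mat[OF cV mode_occupation_carrier])
  have O: "Ohat \<in> carrier_mat ?d ?d" unfolding O_sum by simp
  have adjO: "mat_adjoint Ohat = Ohat"
    unfolding O_sum using N adjN by (subst mat_adjoint_sum_mat) simp_all
  have PO: "Proj Ne * Ohat = Ohat * Proj Ne" for Ne
  proof -
    \<comment> \<open>Padding with identities turns both one-sided products into instances of the
      two-sided sum rule.\<close>
    have "Proj Ne * Ohat = 1\<^sub>m ?d * Ohat * Proj Ne"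
    proof -
      have "Proj Ne * Ohat * 1\<^sub>m ?d = 1\<^sub>m ?d * Ohat * Proj Ne"
        unfolding O_sum sandwich_sum_mat[OF P one_carrier_mat N] sandwich_sum_mat[OF one_carrier_mat P N]
        by (simp only: PN right_mult_one_mat[OF mult_carrier_mat[OF N P]] left_mult_one_mat[OF N])
      then show ?thesis by (simp only: right_mult_one_mat[OF mult_carrier_mat[OF P O]])
    qed
    then show ?thesis by (simp only: left_mult_one_mat[OF O])
  qed

  have blocks: "block_encoding (Proj Ne) n \<Gamma> (a + 1) 0 (prep_select_prep n PREP SELECT) Ohat \<and>
      ((\<forall>\<xi><R. no_leakage (Proj Ne) n (W \<xi>)) \<longrightarrow>
        block_encoding (Proj Ne) n (\<Gamma>\<^sup>2) (a + 2) 0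
          (qsvt2_apply n (square_circuit (a + 1)) (prep_select_prep n PREP SELECT)) (Ohat * Ohat))"
    if prep: "is_prep a c R lam PREP" and sel: "is_select n a c R lam W SELECT"
      and W: "\<forall>\<xi><R. block_encoding (Proj Ne) n 1 1 0 (W \<xi>) (num \<xi>)" for PREP W SELECT Ne
  proof -
    let ?B = "prep_select_prep n PREP SELECT" and ?P = "Proj Ne" and ?E = "\<lambda>\<xi>. encoded_block n 1 (W \<xi>)"
    let ?A = "encoded_block n (a + 1) ?B" and ?k = "complex_of_real (1 / \<Gamma>)"
    have W': "unitary_mat (2 * ?d) (W \<xi>)" "?P * ?E \<xi> * ?P = ?P * num \<xi> * ?P" if "\<xi> < R" for \<xi>
      using W that unfolding block_encoding_exact_iff[OF P] by (auto simp: one_smult_mat)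
    have A: "?A = sum_mat ?d ?d (\<lambda>\<xi>. complex_of_real (lam \<xi> / \<Gamma>) \<cdot>\<^sub>m ?E \<xi>) {..<R}"
      unfolding \<Gamma> by (rule encoded_block_prep_select[OF prep sel inj c unitary_matD(1)[OF W'(1)] pos'])
    have Bu: "unitary_mat (2 ^ (a + 1) * ?d) ?B" by (rule prep_select_prep_unitary[OF prep sel])
    have "?P * ?A * ?P = sum_mat ?d ?d (\<lambda>\<xi>. complex_of_real (lam \<xi> / \<Gamma>) \<cdot>\<^sub>m (?P * ?E \<xi> * ?P)) {..<R}"
      unfolding A by (rule sandwich_sum_mat[OF P P encoded_block_carrier])
    also have "\<dots> = sum_mat ?d ?d (\<lambda>\<xi>. ?k \<cdot>\<^sub>m (complex_of_real (lam \<xi>) \<cdot>\<^sub>m (?P * num \<xi> * ?P))) {..<R}"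
      by (rule sum_mat_cong) (simp add: W'(2)[unfolded One_nat_def] smult_smult_mat)
    also have "\<dots> = ?k \<cdot>\<^sub>m sum_mat ?d ?d (\<lambda>\<xi>. complex_of_real (lam \<xi>) \<cdot>\<^sub>m (?P * num \<xi> * ?P)) {..<R}"
      by (rule smult_sum_mat[symmetric, OF smult_carrier_mat[OF mult_carrier_mat[OF mult_carrier_mat[OF P N] P]]])
    also have "\<dots> = ?k \<cdot>\<^sub>m (?P * Ohat * ?P)"
      unfolding O_sum sandwich_sum_mat[OF P P N] ..
    finally have block: "?P * ?A * ?P = ?k \<cdot>\<^sub>m (?P * Ohat * ?P)" .
    have "block_encoding ?P n \<Gamma> (a + 1) 0 ?B Ohat"
      unfolding block_encoding_exact_iff[OF P] using pos Bu O block by simp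
    moreover have "block_encoding ?P n (\<Gamma>\<^sup>2) (a + 2) 0 (qsvt2_apply n (square_circuit (a + 1)) ?B) (Ohat * Ohat)"
      if leak: "\<forall>\<xi><R. no_leakage ?P n (W \<xi>)"
    proof -
      have a2: "a + 2 = a + 1 + 1" by simp
      \<comment> \<open>The no-leakage condition is linear in the block, so the combination inherits
        it from the \<open>W \<xi>\<close>.\<close>
      have "?A * ?P = 1\<^sub>m ?d * ?A * ?P" by (simp only: left_mult_one_mat[OF encoded_block_carrier])
      also have "\<dots> = sum_mat ?d ?d (\<lambda>\<xi>. complex_of_real (lam \<xi> / \<Gamma>) \<cdot>\<^sub>m (1\<^sub>m ?d * ?E \<xi> * ?P)) {..<R}"
        unfolding A by (rule sandwich_sum_mat[OF one_carrier_mat P encoded_block_carrier])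
      also have "\<dots> = sum_mat ?d ?d (\<lambda>\<xi>. complex_of_real (lam \<xi> / \<Gamma>) \<cdot>\<^sub>m (?P * ?E \<xi> * ?P)) {..<R}"
        using leak by (intro sum_mat_cong) (simp only: left_mult_one_mat[OF encoded_block_carrier] lessThan_iff no_leakage_def)
      also have "\<dots> = ?P * ?A * ?P"
        unfolding A by (rule sandwich_sum_mat[OF P P encoded_block_carrier, symmetric])
      finally have AP: "?A * ?P = ?P * ?A * ?P" .
      have "?P * (mat_adjoint ?A * ?A) * ?P = (?k * ?k) \<cdot>\<^sub>m (?P * (Ohat * Ohat) * ?P)"
        by (rule square_block[OF P O encoded_block_carrier adjP adjO complex_cnj_complex_of_real PP PO AP block])
      moreover have "?k * ?k = complex_of_real (1 / \<Gamma>\<^sup>2)" by (simp add: power2_eq_square)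
      ultimately show ?thesis
        unfolding block_encoding_exact_iff[OF P] a2 encoded_block_square_circuit[OF Bu]
        using pos qsvt2_apply_unitary[OF square_circuit_wf Bu] mult_carrier_mat[OF O O] by simp
    qed
    ultimately show ?thesis by blast
  qed

  \<comment> \<open>The block of this unitary is the occupation itself on the whole Fock space. It
    therefore works for every sector simultaneously, and it does not leak because the occupation
    commutes with each sector projector.\<close>
  define W where "W \<xi> = flag_reflection ?d (num \<xi>)" for \<xi>
  have Wu: "unitary_mat (2 * ?d) (W \<xi>)" if "\<xi> < R" for \<xi>
    unfolding W_def by (rule flag_reflection_unitary[OF hermN NN[OF that]])
  have WE: "encoded_block n 1 (W \<xi>) = num \<xi>" for \<xi>
    unfolding W_def by (rule encoded_block_flag_reflection[OF N])
  have Wb: "block_encoding (Proj Ne) n 1 1 0 (W \<xi>) (num \<xi>) \<and> no_leakage (Proj Ne) n (W \<xi>)" if "\<xi> < R" for Ne \<xi>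
  proof
    show "block_encoding (Proj Ne) n 1 1 0 (W \<xi>) (num \<xi>)"
      unfolding block_encoding_exact_iff[OF P] WE using Wu[OF that] N by (simp add: one_smult_mat)
    show "no_leakage (Proj Ne) n (W \<xi>)"
      unfolding no_leakage_def WE PN by (simp only: assoc_mult_mat[OF N P P] PP)
  qed
  obtain PREP where prep: "is_prep a c R lam PREP" using exists_prep[OF inj c pos'] by blast
  obtain SELECT where sel: "is_select n a c R lam W SELECT" using exists_select[where W = W, OF inj c Wu] by blast
  have sq: "block_encoding (Proj Ne) n (\<Gamma>\<^sup>2) (a + 2) 0
      (qsvt2_apply n (square_circuit (a + 1)) (prep_select_prep n PREP SELECT)) (Ohat * Ohat)" for Ne
    using blocks[OF prep sel] Wb by blast
  show ?case
  proof (intro conjI)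
    show "\<exists>X. \<forall>Ne. block_encoding (Proj Ne) n (\<Gamma>\<^sup>2) (a + 2) 0 X (Ohat * Ohat)"
      by (intro exI allI) (rule sq)
    show "\<forall>\<xi><R. hermitian_mat (2 ^ n) (num \<xi>) \<and> num \<xi> * num \<xi> = num \<xi> \<and>
        (\<forall>\<eta><R. num \<xi> * num \<eta> = num \<eta> * num \<xi>)"
      by (intro allI impI conjI hermN NN NNc)
    show "\<exists>PREP W SELECT. is_prep a c R lam PREP \<and> is_select n a c R lam W SELECT \<and>
        (\<forall>Ne. \<forall>\<xi><R. block_encoding (Proj Ne) n 1 1 0 (W \<xi>) (num \<xi>) \<and> no_leakage (Proj Ne) n (W \<xi>))"
      by (rule exI[of _ PREP], rule exI[of _ W], rule exI[of _ SELECT])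
        (intro conjI allI impI prep sel Wb[THEN conjunct1] Wb[THEN conjunct2])
  qed (intro allI impI, rule blocks)
qed

end
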